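(* Let $A$ be a unital $C^*$-algebra, let $U$ be a bounded linear operator on $\ell^2(A)$, and let $X=\{x_n\}$ and $Y=\{y_n\}$ be two modular Riesz bases for a finitely or countably generated Hilbert $A$-module $E$. Then $U$ is invertible if and only if the generalized Riesz multiplier $\mathbf{M}_{U,Y,X}$ is invertible.
   Context: Hilbert $A$-modules are left modules whose $A$-valued inner product is $A$-linear in the first argument. $\ell^2(A)$ is the Hilbert $A$-module of sequences $\{a_n\}$ in $A$ such that $\sum_n a_na_n^*$ converges in norm, with $\langle\{a_n\},\{b_n\}\rangle=\sum_n a_nb_n^*$. Its standard orthonormal basis is $\{e_n\}$, where $e_n$ has $1_A$ in position $n$ and $0$ elsewhere. A sequence $\{x_n\}\subset E$ is a modular Riesz basis for $E$ if there is an adjointable and invertible operator $V:\ell^2(A)\to E$ with $V(e_n)=x_n$ for each $n$. A modular Riesz basis is in particular a standard frame, so its analysis operator $T_X:E\to\ell^2(A)$, $T_Xx=\{\langle x,x_n\rangle\}_n$, is a well-defined adjointable operator with adjoint $T_X^*(\{a_n\})=\sum_n a_nx_n$. The generalized (Riesz) multiplier with symbol $U$ is $\mathbf{M}_{U,Y,X}=T_Y^*UT_X:E\to E$. Invertible means bijective with bounded inverse. *)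

theory Defs
  imports "HOL-Analysis.Analysis"
begin

class complex_normed_vector = real_normed_vector +
  fixes scaleC :: "complex \<Rightarrow> 'a \<Rightarrow> 'a"  (infixr \<open>*\<^sub>C\<close> 75)
  assumes scaleC_add_right: "c *\<^sub>C (x + y) = c *\<^sub>C x + c *\<^sub>C y"
    and scaleC_add_left: "(c + d) *\<^sub>C x = c *\<^sub>C x + d *\<^sub>C x"
    and scaleC_scaleC: "c *\<^sub>C d *\<^sub>C x = (c * d) *\<^sub>C x"
    and scaleR_scaleC: "r *\<^sub>R x = complex_of_real r *\<^sub>C x"
    and norm_scaleC: "norm (c *\<^sub>C x) = cmod c * norm x"

class complex_banach = complex_normed_vector + banach

text \<open>\<^class>\<open>monoid_mult\<close> rather than \<^class>\<open>real_normed_algebra_1\<close> provides the unit,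
  so that the zero algebra is not excluded.\<close>

class unital_cstar_algebra = complex_banach + real_normed_algebra + monoid_mult +
  fixes star :: "'a \<Rightarrow> 'a"
  assumes mult_scaleC_left: "(c *\<^sub>C a) * b = c *\<^sub>C (a * b)"
    and mult_scaleC_right: "a * (c *\<^sub>C b) = c *\<^sub>C (a * b)"
    and star_add: "star (a + b) = star a + star b"
    and star_scaleC: "star (c *\<^sub>C a) = cnj c *\<^sub>C star a"
    and star_mult: "star (a * b) = star b * star a"
    and star_star: "star (star a) = a"
    and norm_star_mult_self: "norm (star a * a) = (norm a)\<^sup>2"

definition cstar_positive :: "'a::unital_cstar_algebra \<Rightarrow> bool" where
  "cstar_positive a \<longleftrightarrow> (\<exists>b. a = star b * b)"

text \<open>The norm of a Hilbert module is the one induced by its inner product. It is identified with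
  the norm of the ambient complex Banach space type; that the induced norm satisfies the norm
  axioms is a standard consequence of the inner product axioms, so this loses no generality.\<close>

locale hilbert_module =
  fixes act :: "'a::unital_cstar_algebra \<Rightarrow> 'e::complex_banach \<Rightarrow> 'e"
    and ip :: "'e \<Rightarrow> 'e \<Rightarrow> 'a"
  assumes act_add_right: "act a (x + y) = act a x + act a y"
    and act_add_left: "act (a + b) x = act a x + act b x"
    and act_act: "act a (act b x) = act (a * b) x"
    and act_one: "act 1 x = x"
    and act_scaleC_left: "act (c *\<^sub>C a) x = c *\<^sub>C act a x"
    and act_scaleC_right: "act a (c *\<^sub>C x) = c *\<^sub>C act a x"
    and ip_add_left: "ip (x + y) z = ip x z + ip y z"
    and ip_act_left: "ip (act a x) y = a * ip x y"
    and ip_commute: "ip y x = star (ip x y)"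
    and ip_positive: "cstar_positive (ip x x)"
    and ip_eq_zero_iff: "ip x x = 0 \<longleftrightarrow> x = 0"
    and norm_eq_sqrt_ip: "norm x = sqrt (norm (ip x x))"

definition module_span :: "('a \<Rightarrow> 'e \<Rightarrow> 'e::comm_monoid_add) \<Rightarrow> 'e set \<Rightarrow> 'e set" where
  "module_span act S = {\<Sum>x\<in>F. act (c x) x | F c. finite F \<and> F \<subseteq> S}"

definition finitely_generated ::
    "('a::unital_cstar_algebra \<Rightarrow> 'e::complex_banach \<Rightarrow> 'e) \<Rightarrow> bool" where
  "finitely_generated act \<longleftrightarrow> (\<exists>S. finite S \<and> module_span act S = UNIV)"

definition countably_generated ::
    "('a::unital_cstar_algebra \<Rightarrow> 'e::complex_banach \<Rightarrow> 'e) \<Rightarrow> bool" where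
  "countably_generated act \<longleftrightarrow> (\<exists>S. countable S \<and> closure (module_span act S) = UNIV)"

text \<open>The module of square-summable sequences is represented as a set of functions, with pointwise
  operations. Operators between Hilbert modules are therefore functions considered on a given set.\<close>

definition ell2 :: "(nat \<Rightarrow> 'a::unital_cstar_algebra) set" where
  "ell2 = {a. summable (\<lambda>n. a n * star (a n))}"

definition ell2_ip :: "(nat \<Rightarrow> 'a::unital_cstar_algebra) \<Rightarrow> (nat \<Rightarrow> 'a) \<Rightarrow> 'a" where
  "ell2_ip a b = (\<Sum>n. a n * star (b n))"

definition ell2_norm :: "(nat \<Rightarrow> 'a::unital_cstar_algebra) \<Rightarrow> real" where
  "ell2_norm a = sqrt (norm (ell2_ip a a))"

definition ell2_basis :: "nat \<Rightarrow> nat \<Rightarrow> 'a::unital_cstar_algebra" where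
  "ell2_basis n = (\<lambda>m. if m = n then 1 else 0)"

definition bounded_on :: "'x set \<Rightarrow> ('x \<Rightarrow> real) \<Rightarrow> ('y \<Rightarrow> real) \<Rightarrow> ('x \<Rightarrow> 'y) \<Rightarrow> bool" where
  "bounded_on S normS normT f \<longleftrightarrow> (\<exists>K. \<forall>x\<in>S. normT (f x) \<le> K * normS x)"

definition invertible_on ::
    "'x set \<Rightarrow> ('x \<Rightarrow> real) \<Rightarrow> 'y set \<Rightarrow> ('y \<Rightarrow> real) \<Rightarrow> ('x \<Rightarrow> 'y) \<Rightarrow> bool" where
  "invertible_on S normS T normT f \<longleftrightarrow>
     bij_betw f S T \<and> bounded_on T normT normS (inv_into S f)"

text \<open>Linearity and boundedness of an adjointable map are automatic, hence not part of the
  definition.\<close>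

definition adjointable_on ::
    "'x set \<Rightarrow> ('x \<Rightarrow> 'x \<Rightarrow> 'a) \<Rightarrow> 'y set \<Rightarrow> ('y \<Rightarrow> 'y \<Rightarrow> 'a) \<Rightarrow> ('x \<Rightarrow> 'y) \<Rightarrow> bool" where
  "adjointable_on S ipS T ipT f \<longleftrightarrow>
     f \<in> S \<rightarrow> T \<and> (\<exists>g \<in> T \<rightarrow> S. \<forall>x\<in>S. \<forall>y\<in>T. ipT (f x) y = ipS x (g y))"

text \<open>Bounded complex-linear operators; linearity over the algebra is not required.\<close>

definition ell2_bounded_linear ::
    "((nat \<Rightarrow> 'a::unital_cstar_algebra) \<Rightarrow> (nat \<Rightarrow> 'a)) \<Rightarrow> bool" where
  "ell2_bounded_linear U \<longleftrightarrow>
     U \<in> ell2 \<rightarrow> ell2 \<and>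
     (\<forall>a\<in>ell2. \<forall>b\<in>ell2. U (\<lambda>n. a n + b n) = (\<lambda>n. U a n + U b n)) \<and>
     (\<forall>c. \<forall>a\<in>ell2. U (\<lambda>n. c *\<^sub>C a n) = (\<lambda>n. c *\<^sub>C U a n)) \<and>
     bounded_on ell2 ell2_norm ell2_norm U"

definition modular_riesz_basis ::
    "('e::complex_banach \<Rightarrow> 'e \<Rightarrow> 'a::unital_cstar_algebra) \<Rightarrow> (nat \<Rightarrow> 'e) \<Rightarrow> bool" where
  "modular_riesz_basis ip X \<longleftrightarrow>
     (\<exists>V. adjointable_on ell2 ell2_ip UNIV ip V \<and>
          invertible_on ell2 ell2_norm UNIV norm V \<and>
          (\<forall>n. V (ell2_basis n) = X n))"

definition analysis_op :: "('e \<Rightarrow> 'e \<Rightarrow> 'a) \<Rightarrow> (nat \<Rightarrow> 'e) \<Rightarrow> 'e \<Rightarrow> nat \<Rightarrow> 'a" where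
  "analysis_op ip X x = (\<lambda>n. ip x (X n))"

text \<open>For a modular Riesz basis this is the adjoint of the analysis operator.\<close>

definition synthesis_op ::
    "('a \<Rightarrow> 'e \<Rightarrow> 'e::complex_banach) \<Rightarrow> (nat \<Rightarrow> 'e) \<Rightarrow> (nat \<Rightarrow> 'a) \<Rightarrow> 'e" where
  "synthesis_op act X a = (\<Sum>n. act (a n) (X n))"

definition riesz_multiplier ::
    "('a \<Rightarrow> 'e \<Rightarrow> 'e::complex_banach) \<Rightarrow> ('e \<Rightarrow> 'e \<Rightarrow> 'a) \<Rightarrow>
     ((nat \<Rightarrow> 'a) \<Rightarrow> (nat \<Rightarrow> 'a)) \<Rightarrow> (nat \<Rightarrow> 'e) \<Rightarrow> (nat \<Rightarrow> 'e) \<Rightarrow> 'e \<Rightarrow> 'e" where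
  "riesz_multiplier act ip U Y X = synthesis_op act Y \<circ> U \<circ> analysis_op ip X"

end

(*
A modular Riesz basis X is the image of the standard basis under a bijection V whose adjoint V*
is the analysis operator of X; the synthesis operator of Y is the corresponding bijection W. Hence
the multiplier is W U V*, and it suffices that V* is bijective and that V, V*, W and their inverses
are bounded. Boundedness of V is uniform boundedness. For surjectivity of V*, the operator
T = V V* is self-adjoint and bounded below, so T + i t is bounded below uniformly in real t, and the
continuity method carries surjectivity from large t to t = 0.

The Cauchy-Schwarz inequality on sequences rests on monotonicity of the norm on positive elements,
which is derived from the C*-identity without spectral theory: an element x with c^2 - x^2 positive
is the real part of c times a unitary.
*)
theory Submission
  imports Defs
begin

section \<open>The order of a unital $C^*$-algebra\<close>

text \<open>Closed submodules of a Hilbert module need not be complemented: that the range of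
  \<open>V'\<close> is closed with zero orthogonal complement does not make it all of
  \<open>ell2\<close>. Surjectivity of the adjoint therefore has no Hilbert space shortcut. It is
  proved for \<open>V V'\<close>, which acts on the Banach space \<open>'e\<close>, and injectivity
  of \<open>V\<close> brings it back to \<open>V'\<close>. Since \<open>ell2\<close> is a set of
  functions, Banach space theorems are applied on the module side only; neither completeness of
  \<open>ell2\<close> nor the triangle inequality there is established. Invertibility tolerates
  constants, so a parallelogram estimate with factor 2 and a Cauchy-Schwarz estimate with factor 4
  suffice. Positivity enters as a norm condition, for which sums are easy and
  \<open>star b * b\<close> is hard. Square roots are available only after a shift by \<epsilon>,
  hence the quantitative estimates and the limits.\<close>

lemma star_simps [simp]:
  fixes a b :: "'a::unital_cstar_algebra"
  shows "star 0 = (0::'a)" "star (- a) = - star a" "star (a - b) = star a - star b"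
    "star (r *\<^sub>R a) = r *\<^sub>R star a" "star (1::'a) = 1"
    "star (a + b) = star a + star b" "star (a * b) = star b * star a" "star (star a) = a"
    "star (c *\<^sub>C a) = cnj c *\<^sub>C star a"
proof -
  show 0: "star 0 = (0::'a)"
    using star_add[of 0 0] by simp
  have neg: "star (- a) = - star a" for a :: 'a
    using star_add[of a "- a"] 0 by (simp add: eq_neg_iff_add_eq_0 add.commute)
  show "star (- a) = - star a"
    by (fact neg)
  show "star (a - b) = star a - star b"
    using star_add[of a "- b"] by (simp add: neg)
  show "star (r *\<^sub>R a) = r *\<^sub>R star a"
    by (simp add: scaleR_scaleC star_scaleC)
  have "star (star 1 * 1) = star (1::'a) * 1"
    by (simp only: star_mult star_star)
  then show "star (1::'a) = 1"
    by (simp add: star_star)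
qed (simp_all add: star_add star_mult star_star star_scaleC)

lemma scaleC_one [simp]: "1 *\<^sub>C (x::'a::complex_normed_vector) = x"
  using scaleR_scaleC[of 1 x] by simp

lemma scaleC_minus_left: "(- c) *\<^sub>C (x::'a::complex_normed_vector) = - (c *\<^sub>C x)"
  using scaleC_add_left[of c "- c" x] scaleR_scaleC[of 0 x]
  by (simp add: eq_neg_iff_add_eq_0 add.commute)

lemma scaleC_minus_right: "c *\<^sub>C (- x::'a::complex_normed_vector) = - (c *\<^sub>C x)"
  using scaleC_scaleC[of c "-1" x] scaleC_scaleC[of "-1" c x]
  by (simp add: scaleC_minus_left)

lemma scaleC_diff_right: "c *\<^sub>C (x - y::'a::complex_normed_vector) = c *\<^sub>C x - c *\<^sub>C y"
  using scaleC_add_right[of c x "- y"] by (simp add: scaleC_minus_right)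

lemma scaleC_scaleR: "c *\<^sub>C (r *\<^sub>R x::'a::complex_normed_vector) = r *\<^sub>R (c *\<^sub>C x)"
  by (simp add: scaleR_scaleC scaleC_scaleC mult.commute)

lemma commutes_mult:
  fixes z :: "'a::semigroup_mult"
  assumes "z * a = a * z" "z * b = b * z"
  shows "z * (a * b) = a * b * z"
proof -
  have "z * (a * b) = a * (z * b)"
    by (simp add: assms(1) flip: mult.assoc)
  then show ?thesis
    by (simp add: assms(2) mult.assoc)
qed

lemma norm_mult_le:
  fixes a b :: "'a::real_normed_algebra"
  assumes "norm a \<le> r" "norm b \<le> s"
  shows "norm (a * b) \<le> r * s"
proof -
  have "0 \<le> r"
    using assms(1) norm_ge_zero order_trans by blast
  then have "norm a * norm b \<le> r * s"
    by (intro mult_mono assms) simp_all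
  then show ?thesis
    using norm_mult_ineq order_trans by blast
qed

lemma norm_star [simp]: "norm (star a) = norm (a::'a::unital_cstar_algebra)"
proof -
  have le: "norm b \<le> norm (star b)" for b :: 'a
  proof (cases "b = 0")
    case False
    have "norm b * norm b \<le> norm (star b) * norm b"
      using norm_mult_ineq[of "star b" b] by (simp add: norm_star_mult_self power2_eq_square)
    then show ?thesis
      using False by simp
  qed simp
  show ?thesis
    using le[of a] le[of "star a"] by simp
qed

text \<open>In the zero algebra, which the class admits, \<open>1\<close> has norm 0; hence only an
  upper bound, here and for the multiples of \<open>1\<close>.\<close>

lemma norm_one_le: "norm (1::'a::unital_cstar_algebra) \<le> 1"
  using norm_star_mult_self[of "1::'a"] by (auto simp: power2_eq_square)

lemma norm_scaleR_one_le: "norm (r *\<^sub>R (1::'a::unital_cstar_algebra)) \<le> \<bar>r\<bar>"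
  using mult_left_mono[OF norm_one_le, of "\<bar>r\<bar>"] by simp

lemma norm_selfadjoint_square:
  "star h = h \<Longrightarrow> norm (h * h) = (norm (h::'a::unital_cstar_algebra))\<^sup>2"
  using norm_star_mult_self[of h] by simp

lemma continuous_on_star: "continuous_on UNIV (star :: 'a::unital_cstar_algebra \<Rightarrow> 'a)"
proof -
  have "bounded_linear (star :: 'a \<Rightarrow> 'a)"
    by (rule bounded_linear_intro[where K=1]) simp_all
  then show ?thesis
    by (simp add: linear_continuous_on)
qed

text \<open>The root is \<open>1 - y\<close>, where \<open>y\<close> is the fixed point of the contraction
  \<open>y \<mapsto> (x + y\<^sup>2) / 2\<close> on a ball of radius less than 1.\<close>

lemma sqrt_one_minus:
  fixes x :: "'a::unital_cstar_algebra"
  assumes "star x = x" "norm x < 1"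
  obtains w where "star w = w" "w * w = 1 - x" "norm (1 - w) \<le> 1"
    "\<And>z. z * x = x * z \<Longrightarrow> z * w = w * z"
proof -
  \<comment> \<open>The smaller root of \<open>\<rho>\<^sup>2 - 2 * \<rho> + norm x = 0\<close>: the
    ball of this radius is mapped into itself, and \<rho> is also the contraction constant.\<close>
  define \<rho> where "\<rho> = 1 - sqrt (1 - norm x)"
  have \<rho>: "0 \<le> \<rho>" "\<rho> < 1"
    using assms by (auto simp: \<rho>_def)
  have \<rho>2: "(norm x + \<rho> * \<rho>) / 2 = \<rho>"
  proof -
    have "sqrt (1 - norm x) * sqrt (1 - norm x) = 1 - norm x"
      using assms by simp
    then show ?thesis
      by (simp add: \<rho>_def field_simps)
  qed
  \<comment> \<open>Self-adjointness and commutation are closed conditions preserved by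
    \<open>f\<close>. Building them into \<open>S\<close> hands them to the fixed point.\<close>
  define S where "S = {y. norm y \<le> \<rho> \<and> star y = y \<and> (\<forall>z. z * x = x * z \<longrightarrow> z * y = y * z)}"
  define f where "f y = (1/2) *\<^sub>R (x + y * y)" for y
  have "closed {y. norm y \<le> \<rho>}" "closed {y::'a. star y = y}"
    by (auto intro!: closed_Collect_le closed_Collect_eq continuous_intros continuous_on_star)
  moreover have "closed {y. z * x = x * z \<longrightarrow> z * y = y * z}" for z
    by (cases "z * x = x * z") (auto intro!: closed_Collect_eq continuous_intros)
  moreover have "S = {y. norm y \<le> \<rho>} \<inter> {y. star y = y} \<inter> (\<Inter>z. {y. z * x = x * z \<longrightarrow> z * y = y * z})"
    unfolding S_def by auto
  ultimately have "closed S"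
    by (auto intro!: closed_Int closed_INT)
  then have "complete S"
    by (simp add: complete_eq_closed)
  moreover have "S \<noteq> {}"
    using \<rho> by (auto simp: S_def intro!: exI[of _ 0])
  moreover have "f ` S \<subseteq> S"
  proof safe
    fix y assume y: "y \<in> S"
    have "norm (f y) \<le> (norm x + \<rho> * \<rho>) / 2"
    proof -
      have "norm (y * y) \<le> \<rho> * \<rho>"
        using y by (intro norm_mult_le) (simp_all add: S_def)
      then show ?thesis
        using norm_triangle_ineq[of x "y * y"] by (simp add: f_def)
    qed
    moreover have "z * f y = f y * z" if "z * x = x * z" for z
    proof -
      have zy: "z * y = y * z"
        using that y by (simp add: S_def)
      have "z * (y * y) = y * y * z"
        by (rule commutes_mult[OF zy zy])
      then show ?thesis
        by (simp add: f_def distrib_left distrib_right that)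
    qed
    moreover have "star (f y) = f y"
    proof -
      have "star y = y"
        using y unfolding S_def by blast
      then show ?thesis
        using assms by (simp add: f_def)
    qed
    ultimately show "f y \<in> S"
      using \<rho>2 unfolding S_def by auto
  qed
  moreover have "dist (f y) (f y') \<le> \<rho> * dist y y'" if "y \<in> S" "y' \<in> S" for y y'
  proof -
    have "f y - f y' = (1/2) *\<^sub>R (y * (y - y') + (y - y') * y')"
      by (simp add: f_def algebra_simps)
    then have "2 * dist (f y) (f y') = norm (y * (y - y') + (y - y') * y')"
      by (simp add: dist_norm)
    moreover have "norm (y * (y - y')) \<le> \<rho> * norm (y - y')"
      using that by (intro norm_mult_le) (simp_all add: S_def)
    moreover have "norm ((y - y') * y') \<le> norm (y - y') * \<rho>"
      using that by (intro norm_mult_le) (simp_all add: S_def)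
    ultimately show ?thesis
      using norm_triangle_ineq[of "y * (y - y')" "(y - y') * y'"]
      by (simp add: dist_norm mult.commute)
  qed
  ultimately have "\<exists>!y. y \<in> S \<and> f y = y"
    using Banach_fix[of S \<rho> f] \<rho> by blast
  then obtain y where y: "y \<in> S" "f y = y"
    by blast
  have "y + y = 2 *\<^sub>R f y"
    by (simp add: y(2) scaleR_2)
  then have "y + y = x + y * y"
    by (simp add: f_def)
  then have "(1 - y) * (1 - y) = 1 - x"
    by (simp add: algebra_simps)
  show thesis
  proof (rule that)
    show "(1 - y) * (1 - y) = 1 - x" by fact
    have y': "norm y \<le> \<rho>" "star y = y" "\<And>z. z * x = x * z \<Longrightarrow> z * y = y * z"
      using y(1) unfolding S_def by blast+
    then show "star (1 - y) = 1 - y" "norm (1 - (1 - y)) \<le> 1"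
      using \<rho> by simp_all
    show "z * (1 - y) = (1 - y) * z" if "z * x = x * z" for z
      using y'(3)[OF that] by (simp add: left_diff_distrib right_diff_distrib)
  qed
qed

text \<open>The cross terms cancel because \<open>h\<close> and \<open>w\<close> commute. When
  \<open>h * h + w * w\<close> is a multiple of \<open>1\<close>, this controls the norm of
  \<open>h + \<i> *\<^sub>C w\<close> through the C*-identity.\<close>

lemma add_imaginary_adjoint_mult:
  fixes h w :: "'a::unital_cstar_algebra"
  assumes "star h = h" "star w = w" "h * w = w * h"
  shows "star (h + \<i> *\<^sub>C w) * (h + \<i> *\<^sub>C w) = h * h + w * w"
  using assms
  by (simp add: algebra_simps mult_scaleC_left mult_scaleC_right scaleC_scaleC scaleC_minus_left
      scaleC_diff_right)

text \<open>\<open>h\<close> is the mean of \<open>h + \<i> *\<^sub>C w\<close> and its adjoint,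
  which have the same norm.\<close>

lemma norm_le_add_imaginary:
  fixes h w :: "'a::unital_cstar_algebra"
  assumes "star h = h" "star w = w"
  shows "norm h \<le> norm (h + \<i> *\<^sub>C w)"
proof -
  have "(h + \<i> *\<^sub>C w) + star (h + \<i> *\<^sub>C w) = 2 *\<^sub>R h"
    using assms by (simp add: scaleC_minus_left scaleR_2)
  then have "2 * norm h \<le> norm (h + \<i> *\<^sub>C w) + norm (star (h + \<i> *\<^sub>C w))"
    using norm_triangle_ineq[of "h + \<i> *\<^sub>C w" "star (h + \<i> *\<^sub>C w)"] by simp
  then show ?thesis
    by (simp only: norm_star)
qed

text \<open>\<open>h\<close> is the real part of the unitary \<open>h + \<i> sqrt (1 - h\<^sup>2)\<close>.\<close>

lemma norm_one_minus_square:
  fixes h :: "'a::unital_cstar_algebra"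
  assumes h: "star h = h" "norm h < 1"
  shows "norm (1 - h * h) \<le> 1"
proof -
  have "norm (h * h) < 1"
    using h by (simp add: norm_selfadjoint_square power_less_one_iff)
  moreover have "star (h * h) = h * h"
    using h by simp
  ultimately obtain w where w: "star w = w" "w * w = 1 - h * h"
    "\<And>z. z * (h * h) = (h * h) * z \<Longrightarrow> z * w = w * z"
    using sqrt_one_minus[of "h * h"] by blast
  have hw: "h * w = w * h"
    by (rule w(3)) (simp add: mult.assoc)
  define u where "u = h + \<i> *\<^sub>C w"
  have "(norm u)\<^sup>2 = norm (1::'a)"
    using add_imaginary_adjoint_mult[OF h(1) w(1) hw] norm_star_mult_self[of u] w(2)
    by (simp add: u_def)
  then have "(norm u)\<^sup>2 \<le> 1"
    using norm_one_le by simp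
  then have u: "norm (u * u) \<le> 1" "norm (star u * star u) \<le> 1"
    using norm_mult_ineq[of u u] norm_mult_ineq[of "star u" "star u"]
    by (simp_all add: power2_eq_square)
  \<comment> \<open>The double angle formula 4 (1 - cos^2 t) = 2 - 2 cos 2t, with \<open>u\<close>
    in the role of exp (i t).\<close>
  have "u * u + star u * star u = 2 *\<^sub>R (h * h - w * w)"
    using h w hw
    by (simp add: u_def algebra_simps mult_scaleC_left mult_scaleC_right scaleC_scaleC
        scaleC_minus_left scaleC_diff_right scaleC_add_right scaleR_2)
  moreover have "4 *\<^sub>R y = 2 *\<^sub>R y + 2 *\<^sub>R y" for y :: 'a
    by (simp flip: scaleR_add_left)
  ultimately have eq: "4 *\<^sub>R (1 - h * h) = 2 *\<^sub>R 1 - (u * u + star u * star u)"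
    by (simp add: w(2) scaleR_diff_right)
  have "4 * norm (1 - h * h) = norm (2 *\<^sub>R 1 - (u * u + star u * star u))"
    by (simp flip: eq)
  also have "\<dots> \<le> norm (2 *\<^sub>R (1::'a)) + (norm (u * u) + norm (star u * star u))"
    by (rule order_trans[OF norm_triangle_ineq4 add_left_mono[OF norm_triangle_ineq]])
  finally have "4 * norm (1 - h * h) \<le> norm (2 *\<^sub>R (1::'a)) + norm (u * u) + norm (star u * star u)"
    by simp
  then show ?thesis
    using u norm_scaleR_one_le[of 2, where 'a='a] by linarith
qed

text \<open>Equivalent to positivity, but visibly closed under sums.\<close>

definition psd :: "'a::unital_cstar_algebra \<Rightarrow> bool" where
  "psd h \<longleftrightarrow> star h = h \<and> (\<exists>t\<ge>0. norm (t *\<^sub>R 1 - h) \<le> t)"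

lemma psdI: "star h = h \<Longrightarrow> 0 \<le> t \<Longrightarrow> norm (t *\<^sub>R 1 - h) \<le> t \<Longrightarrow> psd h"
  unfolding psd_def by blast

lemma psd_selfadjoint: "psd h \<Longrightarrow> star h = h"
  by (simp add: psd_def)

lemma norm_scaled_one_minus_square:
  fixes h :: "'a::unital_cstar_algebra"
  assumes h: "star h = h" "norm h < s"
  shows "norm (s\<^sup>2 *\<^sub>R 1 - h * h) \<le> s\<^sup>2"
proof -
  have s: "0 < s"
    using norm_ge_zero[of h] h(2) by linarith
  define g where "g = (1/s) *\<^sub>R h"
  have "norm (1 - g * g) \<le> 1"
    using h s by (intro norm_one_minus_square) (simp_all add: g_def)
  moreover have "s\<^sup>2 *\<^sub>R 1 - h * h = s\<^sup>2 *\<^sub>R (1 - g * g)"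
    using s by (simp add: g_def scaleR_diff_right power2_eq_square)
  ultimately show ?thesis
    using mult_left_mono[of "norm (1 - g * g)" 1 "s\<^sup>2"] by simp
qed

lemma psd_square:
  assumes "star h = h"
  shows "psd (h * h)"
  using norm_scaled_one_minus_square[OF assms, of "norm h + 1"] assms
  by (intro psdI[of _ "(norm h + 1)\<^sup>2"]) simp_all

text \<open>The shift makes the norm of \<open>x\<close> strictly less than 1, as the contraction
  requires, and \<open>h + \<epsilon> *\<^sub>R 1\<close> is
  \<open>r *\<^sub>R (1 - x)\<close>.\<close>

lemma psd_sqrt:
  fixes h :: "'a::unital_cstar_algebra"
  assumes h: "psd h" and \<epsilon>: "\<epsilon> > 0"
  obtains w where "psd w" "w * w = h + \<epsilon> *\<^sub>R 1" "\<And>z. z * h = h * z \<Longrightarrow> z * w = w * z"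
proof -
  obtain t where t: "t \<ge> 0" "norm (t *\<^sub>R 1 - h) \<le> t"
    using h unfolding psd_def by blast
  define r where "r = t + \<epsilon>"
  have r: "r > 0"
    using t \<epsilon> by (simp add: r_def)
  define x where "x = (1/r) *\<^sub>R (t *\<^sub>R 1 - h)"
  have "norm x = norm (t *\<^sub>R 1 - h) / r"
    using r by (simp add: x_def)
  also have "\<dots> < 1"
    using t r \<epsilon> by (simp add: r_def)
  finally have "norm x < 1" .
  moreover have "star x = x"
    using psd_selfadjoint[OF h] by (simp add: x_def)
  ultimately obtain w where w: "star w = w" "w * w = 1 - x" "norm (1 - w) \<le> 1"
    "\<And>z. z * x = x * z \<Longrightarrow> z * w = w * z"
    using sqrt_one_minus[of x] by blast
  show thesis
  proof (rule that)
    show "psd (sqrt r *\<^sub>R w)"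
    proof (rule psdI)
      have "sqrt r *\<^sub>R 1 - sqrt r *\<^sub>R w = sqrt r *\<^sub>R (1 - w)"
        by (simp add: scaleR_diff_right)
      then show "norm (sqrt r *\<^sub>R 1 - sqrt r *\<^sub>R w) \<le> sqrt r"
        using w(3) r by simp
    qed (use w(1) r in simp_all)
    have "(sqrt r *\<^sub>R w) * (sqrt r *\<^sub>R w) = r *\<^sub>R (1 - x)"
      using r w(2) by simp
    also have "\<dots> = r *\<^sub>R 1 - (t *\<^sub>R 1 - h)"
      using r by (simp add: x_def scaleR_diff_right)
    finally show "(sqrt r *\<^sub>R w) * (sqrt r *\<^sub>R w) = h + \<epsilon> *\<^sub>R 1"
      by (simp add: r_def scaleR_add_left)
    show "z * (sqrt r *\<^sub>R w) = (sqrt r *\<^sub>R w) * z" if "z * h = h * z" for z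
    proof -
      have "z * x = x * z"
        using that by (simp add: x_def right_diff_distrib left_diff_distrib)
      then show ?thesis
        by (simp add: w(4))
    qed
  qed
qed

text \<open>The definition grants the bound for some radius; here it holds for every radius from
  \<open>norm h\<close> on, because a small shift of \<open>h\<close> is the square of a
  self-adjoint element, for which the bound is known.\<close>

lemma psd_norm_le:
  fixes h :: "'a::unital_cstar_algebra"
  assumes h: "psd h" and s: "norm h \<le> s"
  shows "norm (s *\<^sub>R 1 - h) \<le> s"
proof (rule field_le_epsilon)
  fix e :: real assume e: "e > 0"
  \<comment> \<open>One third bounds the shift of \<open>h\<close>, one makes the inequality for
    \<open>norm w\<close> strict, and one pays for undoing the shift.\<close>
  define \<epsilon> where "\<epsilon> = e / 3"
  have \<epsilon>: "\<epsilon> > 0"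
    using e by (simp add: \<epsilon>_def)
  obtain w where w: "psd w" "w * w = h + \<epsilon> *\<^sub>R 1"
    using psd_sqrt[OF h \<epsilon>] by blast
  have pos: "0 \<le> s"
    using norm_ge_zero s by (rule order_trans)
  have "(norm w)\<^sup>2 = norm (h + \<epsilon> *\<^sub>R 1)"
    using norm_selfadjoint_square[OF psd_selfadjoint[OF w(1)]] by (simp add: w(2))
  also have "\<dots> \<le> norm h + norm (\<epsilon> *\<^sub>R (1::'a))"
    by (rule norm_triangle_ineq)
  also have "\<dots> < s + 2 * \<epsilon>"
    using norm_scaleR_one_le[of \<epsilon>, where 'a='a] s \<epsilon> by linarith
  finally have "norm w < sqrt (s + 2 * \<epsilon>)"
    by (rule real_less_rsqrt)
  then have "norm ((s + 2 * \<epsilon>) *\<^sub>R 1 - w * w) \<le> s + 2 * \<epsilon>"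
    using norm_scaled_one_minus_square[of w "sqrt (s + 2 * \<epsilon>)"] w pos \<epsilon>
    by (simp add: psd_selfadjoint)
  moreover have "s *\<^sub>R 1 - h = ((s + 2 * \<epsilon>) *\<^sub>R 1 - w * w) - \<epsilon> *\<^sub>R 1"
  proof -
    have "(2 * \<epsilon>) *\<^sub>R (1::'a) = \<epsilon> *\<^sub>R 1 + \<epsilon> *\<^sub>R 1"
      by (simp flip: scaleR_add_left)
    then show ?thesis
      by (simp add: w(2) scaleR_add_left)
  qed
  ultimately have "norm (s *\<^sub>R 1 - h) \<le> (s + 2 * \<epsilon>) + norm (\<epsilon> *\<^sub>R (1::'a))"
    using norm_triangle_ineq4[of "(s + 2 * \<epsilon>) *\<^sub>R 1 - w * w" "\<epsilon> *\<^sub>R 1"] by simp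
  then have "norm (s *\<^sub>R 1 - h) \<le> s + 3 * \<epsilon>"
    using norm_scaleR_one_le[of \<epsilon>, where 'a='a] \<epsilon> by linarith
  then show "norm (s *\<^sub>R 1 - h) \<le> s + e"
    by (simp add: \<epsilon>_def)
qed

text \<open>With the radius fixed as \<open>norm h\<close>, the condition compares continuous
  functions of \<open>h\<close>, so it is closed.\<close>

lemma psd_iff: "psd h \<longleftrightarrow> star h = h \<and> norm (norm h *\<^sub>R 1 - h) \<le> norm h"
  using psd_norm_le[of h "norm h"] psdI[of h "norm h"] psd_selfadjoint[of h] by auto

lemma closed_psd: "closed {h :: 'a::unital_cstar_algebra. psd h}"
proof -
  have "closed {h::'a. star h = h}" "closed {h::'a. norm (norm h *\<^sub>R 1 - h) \<le> norm h}"
    by (intro closed_Collect_le closed_Collect_eq continuous_intros continuous_on_star)+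
  then show ?thesis
    by (simp add: psd_iff closed_Collect_conj)
qed

lemma psd_limit_at_right:
  fixes f :: "real \<Rightarrow> 'a::unital_cstar_algebra"
  assumes "(f \<longlongrightarrow> h) (at_right 0)" "\<And>\<epsilon>. \<epsilon> > 0 \<Longrightarrow> psd (f \<epsilon>)"
  shows "psd h"
proof -
  have "\<forall>\<^sub>F \<epsilon> in at_right 0. f \<epsilon> \<in> {h. psd h}"
    using assms(2) by (simp add: eventually_at_filter)
  then have "h \<in> {h. psd h}"
    by (rule Lim_in_closed_set[OF closed_psd _ trivial_limit_at_right_real assms(1)])
  then show ?thesis
    by simp
qed

lemma psd_add:
  assumes "psd h" "psd k"
  shows "psd (h + k)"
proof -
  obtain s t where st: "s \<ge> 0" "norm (s *\<^sub>R 1 - h) \<le> s" "t \<ge> 0" "norm (t *\<^sub>R 1 - k) \<le> t"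
    using assms unfolding psd_def by blast
  have "(s + t) *\<^sub>R 1 - (h + k) = (s *\<^sub>R 1 - h) + (t *\<^sub>R 1 - k)"
    by (simp add: scaleR_add_left)
  then have "norm ((s + t) *\<^sub>R 1 - (h + k)) \<le> s + t"
    using st(2,4) by (metis norm_triangle_mono)
  then show ?thesis
    using assms st by (intro psdI[of _ "s + t"]) (simp_all add: psd_selfadjoint)
qed

lemma psd_scaleR:
  assumes "psd h" "0 \<le> r"
  shows "psd (r *\<^sub>R h)"
proof -
  obtain t where t: "t \<ge> 0" "norm (t *\<^sub>R 1 - h) \<le> t"
    using assms unfolding psd_def by blast
  have "(r * t) *\<^sub>R 1 - r *\<^sub>R h = r *\<^sub>R (t *\<^sub>R 1 - h)"
    by (simp add: scaleR_diff_right)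
  then have "norm ((r * t) *\<^sub>R 1 - r *\<^sub>R h) \<le> r * t"
    using t assms(2) by (simp add: mult_left_mono)
  then show ?thesis
    using assms t by (intro psdI[of _ "r * t"]) (simp_all add: psd_selfadjoint)
qed

lemma psd_zero: "psd 0"
  by (rule psdI[of _ 0]) simp_all

lemma psd_sum: "(\<And>x. x \<in> F \<Longrightarrow> psd (f x)) \<Longrightarrow> psd (sum f F)"
  by (induction F rule: infinite_finite_induct) (simp_all add: psd_zero psd_add)

lemma psd_norm_diff:
  assumes "star h = h" "norm h \<le> r"
  shows "psd (r *\<^sub>R 1 - h)"
  using assms order_trans[OF norm_ge_zero assms(2)] by (intro psdI[of _ r]) simp_all

text \<open>The shifted factors have commuting self-adjoint roots \<open>w\<close> and
  \<open>v\<close>, so their product is the square of the self-adjoint element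
  \<open>w * v\<close>.\<close>

lemma psd_mult_commute:
  fixes h k :: "'a::unital_cstar_algebra"
  assumes h: "psd h" and k: "psd k" and hk: "h * k = k * h"
  shows "psd (h * k)"
proof (rule psd_limit_at_right)
  show "((\<lambda>\<epsilon>. (h + \<epsilon> *\<^sub>R 1) * (k + \<epsilon> *\<^sub>R 1)) \<longlongrightarrow> h * k) (at_right 0)"
    by (auto intro!: tendsto_eq_intros)
  fix \<epsilon> :: real assume \<epsilon>: "\<epsilon> > 0"
  obtain w where w: "psd w" "w * w = h + \<epsilon> *\<^sub>R 1" "\<And>z. z * h = h * z \<Longrightarrow> z * w = w * z"
    using psd_sqrt[OF h \<epsilon>] by blast
  obtain v where v: "psd v" "v * v = k + \<epsilon> *\<^sub>R 1" "\<And>z. z * k = k * z \<Longrightarrow> z * v = v * z"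
    using psd_sqrt[OF k \<epsilon>] by blast
  have "k * w = w * k"
    using w(3)[of k] hk by simp
  then have wv: "w * v = v * w"
    using v(3)[of w] by simp
  have "(w * w) * (v * v) = w * (w * v) * v"
    by (simp only: mult.assoc)
  also have "\<dots> = w * (v * w) * v"
    by (simp only: wv)
  also have "\<dots> = (w * v) * (w * v)"
    by (simp only: mult.assoc)
  finally have "(w * w) * (v * v) = (w * v) * (w * v)" .
  moreover have "psd ((w * v) * (w * v))"
    using w(1) v(1) wv by (intro psd_square) (simp add: psd_selfadjoint)
  ultimately show "psd ((h + \<epsilon> *\<^sub>R 1) * (k + \<epsilon> *\<^sub>R 1))"
    using w(2) v(2) by simp
qed

text \<open>\<open>x\<close> is the real part of \<open>x + \<i> sqrt (c\<^sup>2 - x\<^sup>2)\<close>, which is \<open>c\<close> times a unitary.\<close>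

lemma norm_le_if_psd_square:
  fixes x :: "'a::unital_cstar_algebra"
  assumes x: "star x = x" and c: "0 \<le> c" "psd (c\<^sup>2 *\<^sub>R 1 - x * x)"
  shows "norm x \<le> c"
proof -
  have "(norm x)\<^sup>2 \<le> c\<^sup>2 + \<epsilon>" if \<epsilon>: "\<epsilon> > 0" for \<epsilon>
  proof -
    obtain v where v: "psd v" "v * v = (c\<^sup>2 *\<^sub>R 1 - x * x) + \<epsilon> *\<^sub>R 1"
      "\<And>z. z * (c\<^sup>2 *\<^sub>R 1 - x * x) = (c\<^sup>2 *\<^sub>R 1 - x * x) * z \<Longrightarrow> z * v = v * z"
      using psd_sqrt[OF c(2) \<epsilon>] by blast
    have "x * v = v * x"
      by (rule v(3)) (simp add: right_diff_distrib left_diff_distrib mult.assoc)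
    then have "star (x + \<i> *\<^sub>C v) * (x + \<i> *\<^sub>C v) = (c\<^sup>2 + \<epsilon>) *\<^sub>R 1"
      using add_imaginary_adjoint_mult[OF x psd_selfadjoint[OF v(1)]] v(2)
      by (simp add: scaleR_add_left)
    then have "(norm (x + \<i> *\<^sub>C v))\<^sup>2 = norm ((c\<^sup>2 + \<epsilon>) *\<^sub>R (1::'a))"
      using norm_star_mult_self[of "x + \<i> *\<^sub>C v"] by simp
    also have "\<dots> \<le> c\<^sup>2 + \<epsilon>"
      using norm_scaleR_one_le[of "c\<^sup>2 + \<epsilon>", where 'a='a] \<epsilon> by simp
    finally have "(norm (x + \<i> *\<^sub>C v))\<^sup>2 \<le> c\<^sup>2 + \<epsilon>" .
    moreover have "(norm x)\<^sup>2 \<le> (norm (x + \<i> *\<^sub>C v))\<^sup>2"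
      by (intro power_mono norm_le_add_imaginary x psd_selfadjoint v(1)) simp
    ultimately show ?thesis
      by (rule order_trans[rotated])
  qed
  then have "(norm x)\<^sup>2 \<le> c\<^sup>2"
    by (rule field_le_epsilon)
  then show ?thesis
    using c(1) by (rule power2_le_imp_le)
qed

text \<open>The difference of the squares of \<open>c\<close> and \<open>x\<close> factors into the
  two given positive elements, which commute.\<close>

lemma norm_le_if_psd_bounds:
  fixes x :: "'a::unital_cstar_algebra"
  assumes "psd (c *\<^sub>R 1 - x)" "psd (c *\<^sub>R 1 + x)" and c: "0 \<le> c"
  shows "norm x \<le> c"
proof (rule norm_le_if_psd_square)
  have "psd ((c *\<^sub>R 1 - x) * (c *\<^sub>R 1 + x))"
    using assms by (intro psd_mult_commute) (simp_all add: algebra_simps)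
  moreover have "(c *\<^sub>R 1 - x) * (c *\<^sub>R 1 + x) = c\<^sup>2 *\<^sub>R 1 - x * x"
    by (simp add: algebra_simps power2_eq_square)
  ultimately show "psd (c\<^sup>2 *\<^sub>R 1 - x * x)"
    by simp
  show "star x = x"
    using psd_selfadjoint[OF assms(1)] by simp
qed (fact c)

lemma norm_mono_psd:
  fixes h k :: "'a::unital_cstar_algebra"
  assumes h: "psd h" and k: "psd k"
  shows "norm h \<le> norm (h + k)"
proof (rule norm_le_if_psd_bounds)
  define m where "m = norm (h + k)"
  have "psd (m *\<^sub>R 1 - (h + k))"
    using psd_selfadjoint[OF psd_add[OF h k]] by (intro psd_norm_diff) (simp_all only: m_def)
  from psd_add[OF this k] show "psd (norm (h + k) *\<^sub>R 1 - h)"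
    by (simp add: m_def)
  show "psd (norm (h + k) *\<^sub>R 1 + h)"
    using psd_norm_diff[of "0::'a" "norm (h + k)"] by (simp add: psd_add h)
qed simp

section \<open>Comparison of \<open>c * star c\<close> with \<open>star c * c\<close>\<close>

text \<open>The C*-identity computes the norm of a self-adjoint square exactly; iterating it reaches
  the exponents \<open>2 ^ n\<close>.\<close>

lemma norm_power_selfadjoint:
  fixes x :: "'a::unital_cstar_algebra"
  assumes "star x = x"
  shows "norm (x ^ 2 ^ n) = norm x ^ 2 ^ n"
proof (induction n)
  case (Suc n)
  have sa: "star (x ^ m) = x ^ m" for m
    using assms by (induction m) (simp_all add: power_commutes)
  have "norm (x ^ 2 ^ Suc n) = norm (x ^ 2 ^ n * x ^ 2 ^ n)"
    by (simp add: mult_2 power_add)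
  also have "\<dots> = (norm (x ^ 2 ^ n))\<^sup>2"
    by (rule norm_selfadjoint_square[OF sa])
  also have "\<dots> = norm x ^ 2 ^ Suc n"
    by (simp add: Suc mult_2 power_add power2_eq_square)
  finally show ?case .
qed simp

text \<open>If \<rho> exceeded 1, the square of Bernoulli's inequality would make the powers grow
  quadratically in \<open>2 ^ n\<close>, beyond any linear bound.\<close>

lemma power_unbounded_by_linear:
  fixes \<rho> K :: real
  assumes "\<And>n::nat. \<rho> ^ 2 ^ n \<le> 1 + 2 ^ n * K"
  shows "\<rho> \<le> 1"
proof (rule ccontr)
  define d where "d = \<rho> - 1"
  assume "\<not> \<rho> \<le> 1"
  then have d: "d > 0"
    by (simp add: d_def)
  obtain n where n: "2 * K / d\<^sup>2 < 2 ^ n"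
    using real_arch_pow[of 2 "2 * K / d\<^sup>2"] by auto
  have "1 + 2 ^ n * d \<le> \<rho> ^ 2 ^ n"
    using Bernoulli_inequality[of d "2 ^ n"] d by (simp add: d_def)
  then have "(1 + 2 ^ n * d)\<^sup>2 \<le> (\<rho> ^ 2 ^ n)\<^sup>2"
    using d by (intro power_mono) simp_all
  also have "\<dots> = \<rho> ^ 2 ^ Suc n"
    by (simp add: mult.commute flip: power_mult)
  also have "\<dots> \<le> 1 + 2 ^ Suc n * K"
    by (rule assms)
  finally have "2 ^ n * (2 ^ n * d\<^sup>2) + 2 ^ n * (2 * d) \<le> 2 ^ n * (2 * K)"
    by (simp add: power2_eq_square algebra_simps)
  then have "2 ^ n * (2 ^ n * d\<^sup>2 + 2 * d) \<le> 2 ^ n * (2 * K)"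
    by (simp only: distrib_left)
  then have "2 ^ n * d\<^sup>2 + 2 * d \<le> 2 * K"
    by (rule mult_left_le_imp_le) simp
  moreover have "2 * K < 2 ^ n * d\<^sup>2"
    using n d by (simp add: pos_divide_less_eq)
  ultimately show False
    using d by simp
qed

text \<open>This replaces the fact that \<open>c\<^sup>* c\<close> and \<open>c c\<^sup>*\<close> have the same spectrum up to 0: by
  \<open>(r + c c\<^sup>*)\<^sup>N = r\<^sup>N + c S c\<^sup>*\<close>, where \<open>S\<close> is a sum of \<open>N\<close> powers of \<open>r\<close> and \<open>r + c\<^sup>* c\<close>,
  the norms of \<open>r + c c\<^sup>*\<close> and \<open>r + c\<^sup>* c\<close> can be compared asymptotically.\<close>

lemma norm_swap_le:
  fixes c :: "'a::unital_cstar_algebra"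
  assumes "norm (r *\<^sub>R 1 + star c * c) \<le> t" "0 \<le> r" "r \<le> t" "0 < t"
  shows "norm (r *\<^sub>R 1 + c * star c) \<le> t"
proof -
  define p where "p = r *\<^sub>R 1 + c * star c"
  define q where "q = r *\<^sub>R 1 + star c * c"
  \<comment> \<open>This moves each factor \<open>p\<close> past \<open>c\<close>, where it becomes
    \<open>q\<close>, whose norm is bounded by hypothesis.\<close>
  have pc: "p * c = c * q"
    by (simp add: p_def q_def algebra_simps)
  \<comment> \<open>The recursion sends \<open>S\<close> to
    \<open>r ^ N *\<^sub>R 1 + q * S\<close>. Its norm is at most \<open>N * t ^ (N - 1)\<close>;
    the factor \<open>t\<close> on the left avoids the truncated exponent.\<close>
  have "\<exists>S. p ^ N = r ^ N *\<^sub>R 1 + c * S * star c \<and> t * norm S \<le> N * t ^ N" for N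
  proof (induction N)
    case (Suc N)
    then obtain S where S: "p ^ N = r ^ N *\<^sub>R 1 + c * S * star c" "t * norm S \<le> N * t ^ N"
      by blast
    have "p ^ Suc N = r ^ N *\<^sub>R p + p * c * S * star c"
      by (simp add: S(1) distrib_left mult.assoc)
    also have "\<dots> = r ^ Suc N *\<^sub>R 1 + c * (r ^ N *\<^sub>R 1 + q * S) * star c"
      unfolding pc by (simp add: p_def algebra_simps)
    finally have "p ^ Suc N = r ^ Suc N *\<^sub>R 1 + c * (r ^ N *\<^sub>R 1 + q * S) * star c" .
    moreover have "t * norm (r ^ N *\<^sub>R 1 + q * S) \<le> Suc N * t ^ Suc N"
    proof -
      have "norm (r ^ N *\<^sub>R (1::'a)) \<le> t ^ N"
        using norm_scaleR_one_le[of "r ^ N", where 'a='a] power_mono[of r t N] assms by simp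
      moreover have "norm (q * S) \<le> t * norm S"
        using assms(1) by (intro norm_mult_le) (simp_all add: q_def)
      ultimately have "norm (r ^ N *\<^sub>R 1 + q * S) \<le> t ^ N + N * t ^ N"
        using S(2) norm_triangle_ineq[of "r ^ N *\<^sub>R 1" "q * S"] by linarith
      then have "t * norm (r ^ N *\<^sub>R 1 + q * S) \<le> t * (t ^ N + N * t ^ N)"
        using assms(4) by (intro mult_left_mono) simp_all
      then show ?thesis
        by (simp add: algebra_simps)
    qed
    ultimately show ?case
      by blast
  qed (auto intro!: exI[of _ 0])
  then have pN: "norm (p ^ N) \<le> t ^ N * (1 + N * ((norm c)\<^sup>2 / t))" for N
  proof -
    obtain S where S: "p ^ N = r ^ N *\<^sub>R 1 + c * S * star c" "t * norm S \<le> N * t ^ N"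
      using \<open>\<exists>S. _\<close> by blast
    have "norm (r ^ N *\<^sub>R (1::'a)) \<le> t ^ N"
      using norm_scaleR_one_le[of "r ^ N", where 'a='a] power_mono[of r t N] assms by simp
    moreover have "norm (c * S * star c) \<le> norm c * (N * t ^ N / t) * norm c"
      using S(2) assms(4) by (intro norm_mult_le) (simp_all add: field_simps)
    ultimately have "norm (p ^ N) \<le> t ^ N + norm c * (N * t ^ N / t) * norm c"
      unfolding S(1) by (rule norm_triangle_mono)
    then show ?thesis
      by (simp add: algebra_simps power2_eq_square)
  qed
  have "(norm p / t) ^ 2 ^ n \<le> 1 + 2 ^ n * ((norm c)\<^sup>2 / t)" for n
  proof -
    have "norm p ^ 2 ^ n = norm (p ^ 2 ^ n)"
      by (rule norm_power_selfadjoint[symmetric]) (simp add: p_def)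
    also have "\<dots> \<le> t ^ 2 ^ n * (1 + 2 ^ n * ((norm c)\<^sup>2 / t))"
      using pN[of "2 ^ n"] by simp
    finally show ?thesis
      using assms(4) by (simp add: power_divide pos_divide_le_eq mult.commute)
  qed
  then have "norm p / t \<le> 1"
    by (rule power_unbounded_by_linear)
  then show ?thesis
    using assms(4) by (simp add: p_def)
qed

text \<open>For large \<open>t\<close>, positivity of
  \<open>\<delta> *\<^sub>R 1 - star c * c\<close> bounds the norm of
  \<open>(t - \<delta>) *\<^sub>R 1 + star c * c\<close> by \<open>t\<close>, and this is the bound
  that \<open>norm_swap_le\<close> transfers.\<close>

lemma psd_swap:
  fixes c :: "'a::unital_cstar_algebra"
  assumes "psd (\<delta> *\<^sub>R 1 - star c * c)" "0 \<le> \<delta>"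
  shows "psd (\<delta> *\<^sub>R 1 - c * star c)"
proof -
  define t where "t = norm (\<delta> *\<^sub>R 1 - star c * c) + \<delta> + 1"
  have "norm (t *\<^sub>R 1 - (\<delta> *\<^sub>R 1 - star c * c)) \<le> t"
    using assms by (intro psd_norm_le) (simp_all add: t_def)
  then have "norm ((t - \<delta>) *\<^sub>R 1 + star c * c) \<le> t"
    by (simp add: algebra_simps)
  then have "norm ((t - \<delta>) *\<^sub>R 1 + c * star c) \<le> t"
    using assms(2) by (rule_tac norm_swap_le) (simp_all add: t_def add_nonneg_pos)
  then have "norm (t *\<^sub>R 1 - (\<delta> *\<^sub>R 1 - c * star c)) \<le> t"
    by (simp add: algebra_simps)
  then show ?thesis
    using assms(2) by (intro psdI[of _ t]) (simp_all add: t_def)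
qed

text \<open>Up to sign, \<open>k\<close> and \<open>l\<close> are twice the real and imaginary parts
  of \<open>c\<close>. The sum of their squares is positive before anything is known about
  \<open>star c * c\<close> alone.\<close>

lemma psd_mult_star_add_star_mult:
  fixes c :: "'a::unital_cstar_algebra"
  shows "psd (c * star c + star c * c)"
proof -
  define k where "k = c + star c"
  define l where "l = \<i> *\<^sub>C (c - star c)"
  have "l * l = - ((c - star c) * (c - star c))"
    by (simp add: l_def mult_scaleC_left mult_scaleC_right scaleC_scaleC scaleC_minus_left)
  then have "k * k + l * l = 2 *\<^sub>R (c * star c + star c * c)"
    by (simp add: k_def algebra_simps scaleR_2)
  moreover have "star k = k" "star l = l"
    by (simp_all add: k_def l_def scaleC_minus_left scaleC_diff_right)
  ultimately have "psd (2 *\<^sub>R (c * star c + star c * c))"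
    using psd_add[OF psd_square[of k] psd_square[of l]] by simp
  from psd_scaleR[OF this, of "1/2"] show ?thesis
    by simp
qed

text \<open>The lower bound comes from replacing \<open>star c * c\<close> by
  \<open>- (c * star c)\<close> at the cost of a positive element. For \<delta> = 0 this says that
  \<open>star c * c\<close> is negative only if it vanishes; approximate roots call for general
  \<delta>.\<close>

lemma norm_star_mult_le_if_psd:
  fixes c :: "'a::unital_cstar_algebra"
  assumes "psd (\<delta> *\<^sub>R 1 - star c * c)" "0 \<le> \<delta>"
  shows "norm (star c * c) \<le> \<delta>"
proof (rule norm_le_if_psd_bounds)
  have "psd ((\<delta> *\<^sub>R 1 - c * star c) + (c * star c + star c * c))"
    by (intro psd_add psd_swap psd_mult_star_add_star_mult assms)
  then show "psd (\<delta> *\<^sub>R 1 + star c * c)"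
    by (simp add: algebra_simps)
qed (fact assms)+

text \<open>With \<open>h = b\<^sup>* b\<close>, \<open>w \<approx> |h|\<close> and \<open>n = w - h\<close>, which is nearly twice the negative part of \<open>h\<close>,
  the element \<open>c = b n\<close> satisfies \<open>c\<^sup>* c = n h n \<approx> - w n\<^sup>2\<close>. Hence it is nearly negative, so it
  is small by the preceding lemma, and therefore \<open>n\<close> is small.\<close>

lemma psd_star_mult_self:
  fixes b :: "'a::unital_cstar_algebra"
  shows "psd (star b * b)"
proof -
  define h where "h = star b * b"
  have h: "star h = h"
    by (simp add: h_def)
  have "\<exists>w. psd w \<and> (norm (w - h))\<^sup>2 \<le> 3 * \<epsilon>" if \<epsilon>: "\<epsilon> > 0" for \<epsilon>
  proof -
    obtain w where w: "psd w" "w * w = h * h + \<epsilon> *\<^sub>R 1"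
      "\<And>z. z * (h * h) = (h * h) * z \<Longrightarrow> z * w = w * z"
      using psd_sqrt[OF psd_square[OF h] \<epsilon>] by blast
    have hw: "h * w = w * h"
      by (rule w(3)) (simp add: mult.assoc)
    define n where "n = w - h"
    have n: "star n = n"
      by (simp add: n_def h psd_selfadjoint[OF w(1)])
    have wn: "w * n = n * w"
      by (simp add: n_def algebra_simps hw)
    have hn: "h * n = \<epsilon> *\<^sub>R 1 - w * n"
      by (simp add: n_def algebra_simps hw w(2))
    have nn: "n * n = w * n - h * n"
      by (simp add: n_def algebra_simps)
    define c where "c = b * n"
    have "star c * c = n * (h * n)"
      by (simp add: c_def n h_def mult.assoc)
    also have "\<dots> = \<epsilon> *\<^sub>R n - w * (n * n)"
      by (simp add: hn right_diff_distrib flip: mult.assoc wn)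
    finally have cc: "star c * c = \<epsilon> *\<^sub>R n - w * (n * n)" .
    have pos: "psd (w * (n * n))"
      using commutes_mult[OF wn wn] by (intro psd_mult_commute w(1) psd_square n) simp
    define \<delta> where "\<delta> = \<epsilon> * norm n"
    have \<delta>: "0 \<le> \<delta>"
      using \<epsilon> by (simp add: \<delta>_def)
    have "psd ((\<delta> *\<^sub>R 1 - \<epsilon> *\<^sub>R n) + w * (n * n))"
      using pos \<epsilon> n by (intro psd_add psd_norm_diff) (simp_all add: \<delta>_def)
    then have "psd (\<delta> *\<^sub>R 1 - star c * c)"
      by (simp add: cc algebra_simps)
    then have "norm (star c * c) \<le> \<delta>"
      using \<delta> by (rule norm_star_mult_le_if_psd)
    \<comment> \<open>The bound on \<open>star c * c\<close> thus controls the cube of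
      \<open>n\<close>. One more factor gives the fourth power, whose norm is the fourth power of
      \<open>norm n\<close> by the C*-identity.\<close>
    moreover have "n * (n * n) = \<epsilon> *\<^sub>R n - 2 *\<^sub>R (star c * c)"
    proof -
      have "n * n = 2 *\<^sub>R (w * n) - \<epsilon> *\<^sub>R 1"
        by (simp add: nn hn scaleR_2)
      moreover have "n * (w * n) = w * (n * n)"
        by (simp only: flip: mult.assoc wn)
      ultimately have "n * (n * n) = 2 *\<^sub>R (w * (n * n)) - \<epsilon> *\<^sub>R n"
        by (simp add: right_diff_distrib)
      then show ?thesis
        by (simp only: cc scaleR_2) (simp add: algebra_simps)
    qed
    ultimately have "norm (n * (n * n)) \<le> 3 * \<delta>"
      using norm_triangle_ineq4[of "\<epsilon> *\<^sub>R n" "2 *\<^sub>R (star c * c)"] \<epsilon> by (simp add: \<delta>_def)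
    then have "norm (n * (n * (n * n))) \<le> norm n * (3 * \<delta>)"
      by (rule norm_mult_le[OF order_refl])
    moreover have "norm (n * (n * (n * n))) = (norm n)\<^sup>2 * (norm n)\<^sup>2"
      using norm_selfadjoint_square[of "n * n"] norm_selfadjoint_square[OF n] n
      by (simp add: mult.assoc power2_eq_square)
    ultimately have n4: "(norm n)\<^sup>2 * (norm n)\<^sup>2 \<le> (3 * \<epsilon>) * (norm n)\<^sup>2"
      by (simp add: \<delta>_def power2_eq_square mult_ac)
    have "(norm n)\<^sup>2 \<le> 3 * \<epsilon>"
    proof (cases "n = 0")
      case False
      then show ?thesis
        by (intro mult_right_le_imp_le[OF n4]) simp
    qed (use \<epsilon> in simp)
    then show ?thesis
      using w(1) unfolding n_def by blast
  qed
  note approx = this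
  have "h \<in> closure {h. psd h}"
  proof (unfold closure_approachable, intro allI impI)
    fix e :: real assume e: "e > 0"
    obtain w where w: "psd w" "(norm (w - h))\<^sup>2 \<le> 3 * (e\<^sup>2 / 4)"
      using approx[of "e\<^sup>2 / 4"] e by auto
    have "3 * (e\<^sup>2 / 4) < e\<^sup>2"
      using e by simp
    then have "(norm (w - h))\<^sup>2 < e\<^sup>2"
      using w(2) by linarith
    then have "norm (w - h) < e"
      using e by (simp add: power2_less_imp_less)
    then show "\<exists>y\<in>{h. psd h}. dist y h < e"
      using w(1) by (auto simp: dist_norm)
  qed
  then show ?thesis
    by (simp add: closure_closed[OF closed_psd] h_def)
qed

section \<open>Square-summable sequences\<close>

lemma psd_mult_star_self: "psd (a * star a)"
  using psd_star_mult_self[of "star a"] by simp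

lemma psd_suminf:
  fixes f :: "nat \<Rightarrow> 'a::unital_cstar_algebra"
  assumes "summable f" "\<And>n. psd (f n)"
  shows "psd (suminf f)"
proof -
  have "sum f {..<n} \<in> {h. psd h}" for n
    by (simp add: psd_sum assms(2))
  then have "suminf f \<in> {h. psd h}"
    by (rule closed_sequentially[OF closed_psd _ summable_LIMSEQ[OF assms(1)]])
  then show ?thesis
    by simp
qed

text \<open>Series in \<open>ell2\<close> need not converge absolutely, so norms of single terms are
  of no use. Norm monotonicity on positive elements compares whole blocks and transfers the Cauchy
  criterion.\<close>

lemma summable_comparison_psd:
  fixes f g :: "nat \<Rightarrow> 'a::unital_cstar_algebra"
  assumes f: "summable f" and g: "\<And>n. psd (g n)" and fg: "\<And>n. psd (f n - g n)"
  shows "summable g" "norm (suminf g) \<le> norm (suminf f)"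
proof -
  have "norm (sum g F) \<le> norm (sum f F)" for F
    using norm_mono_psd[of "sum g F" "\<Sum>n\<in>F. f n - g n"] psd_sum[of F "\<lambda>n. f n - g n"]
    by (simp add: psd_sum g fg sum_subtractf)
  then show sg: "summable g"
    using f unfolding summable_Cauchy by (meson le_less_trans)
  have "norm (suminf g) \<le> norm (suminf g + (\<Sum>n. f n - g n))"
    by (intro norm_mono_psd psd_suminf summable_diff f sg g fg)
  also have "suminf g + (\<Sum>n. f n - g n) = suminf f"
    by (simp flip: suminf_diff[OF f sg])
  finally show "norm (suminf g) \<le> norm (suminf f)" .
qed

lemma bounded_linear_scaleC: "bounded_linear (\<lambda>x::'a::complex_normed_vector. c *\<^sub>C x)"
  by (rule bounded_linear_intro[where K="cmod c"])
    (simp_all add: scaleC_add_right scaleC_scaleR norm_scaleC)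

text \<open>The choice of \<open>r\<^sup>2\<close> as \<open>B / A\<close> balances the two terms;
  the shift by \<open>e\<close> admits zeros. This turns the additive bound from polarization into a
  product bound.\<close>

lemma le_four_mult_if_scaled:
  fixes x A B :: real
  assumes "0 \<le> A" "0 \<le> B" "\<And>r. r > 0 \<Longrightarrow> x \<le> 2 * ((r * A)\<^sup>2 + (B / r)\<^sup>2)"
  shows "x \<le> 4 * A * B"
proof -
  have "x \<le> 4 * (A + e) * (B + e)" if e: "e > 0" for e
  proof -
    define r where "r = sqrt ((B + e) / (A + e))"
    have pos: "0 < A + e" "0 < B + e"
      using assms e by simp_all
    then have r: "r > 0" "r\<^sup>2 = (B + e) / (A + e)"
      by (simp_all add: r_def)
    have "(r * A)\<^sup>2 = (B + e) * (A\<^sup>2 / (A + e))" "(B / r)\<^sup>2 = (A + e) * (B\<^sup>2 / (B + e))"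
      using r pos by (simp_all add: power_mult_distrib power_divide)
    moreover have "A\<^sup>2 / (A + e) \<le> A + e" "B\<^sup>2 / (B + e) \<le> B + e"
    proof -
      have "C\<^sup>2 / (C + e) \<le> C + e" if "0 \<le> C" for C
      proof -
        have "C\<^sup>2 \<le> (C + e)\<^sup>2"
          using that e by (intro power_mono) simp_all
        then show ?thesis
          using that e by (simp add: pos_divide_le_eq power2_eq_square)
      qed
      then show "A\<^sup>2 / (A + e) \<le> A + e" "B\<^sup>2 / (B + e) \<le> B + e"
        using assms by simp_all
    qed
    ultimately have "(r * A)\<^sup>2 \<le> (B + e) * (A + e)" "(B / r)\<^sup>2 \<le> (A + e) * (B + e)"
      using pos by (simp_all only: mult_left_mono less_imp_le)
    then have "2 * ((r * A)\<^sup>2 + (B / r)\<^sup>2) \<le> 2 * ((B + e) * (A + e) + (A + e) * (B + e))"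
      by (intro mult_left_mono add_mono) simp_all
    also have "\<dots> = 4 * (A + e) * (B + e)"
      by (simp add: algebra_simps)
    finally show ?thesis
      using assms(3)[OF r(1)] by (rule order_trans[rotated])
  qed
  then have "\<forall>\<^sub>F e in at_right 0. x \<le> 4 * (A + e) * (B + e)"
    by (simp add: eventually_at_filter)
  moreover have "((\<lambda>e. 4 * (A + e) * (B + e)) \<longlongrightarrow> 4 * A * B) (at_right 0)"
    by (auto intro!: tendsto_eq_intros)
  ultimately show ?thesis
    by (intro tendsto_lowerbound) auto
qed

lemma ell2_norm_nonneg [simp]: "0 \<le> ell2_norm a"
  by (simp add: ell2_norm_def)

lemma ell2_norm_square: "(ell2_norm a)\<^sup>2 = norm (ell2_ip a a)"
  by (simp add: ell2_norm_def)

text \<open>By the parallelogram law, the squares of \<open>a n + b n\<close> and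
  \<open>a n - b n\<close> add up to twice those of \<open>a n\<close> and \<open>b n\<close>, so
  the former are dominated.\<close>

lemma ell2_add:
  assumes "a \<in> ell2" "b \<in> ell2"
  shows "(\<lambda>n. a n + b n) \<in> ell2"
    "(ell2_norm (\<lambda>n. a n + b n))\<^sup>2 \<le> 2 * ((ell2_norm a)\<^sup>2 + (ell2_norm b)\<^sup>2)"
proof -
  define f where "f n = 2 *\<^sub>R (a n * star (a n)) + 2 *\<^sub>R (b n * star (b n))" for n
  define g where "g n = (a n + b n) * star (a n + b n)" for n
  have sa: "summable (\<lambda>n. a n * star (a n))" and sb: "summable (\<lambda>n. b n * star (b n))"
    using assms by (simp_all add: ell2_def)
  then have f: "summable f"
    unfolding f_def by (intro summable_add summable_scaleR_right)
  have g: "psd (g n)" for n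
    unfolding g_def by (rule psd_mult_star_self)
  have "f n - g n = (a n - b n) * star (a n - b n)" for n
    by (simp add: f_def g_def algebra_simps scaleR_2)
  then have fg: "psd (f n - g n)" for n
    by (simp only: psd_mult_star_self)
  have "suminf f = 2 *\<^sub>R ell2_ip a a + 2 *\<^sub>R ell2_ip b b"
    unfolding f_def ell2_ip_def using sa sb
    by (simp add: suminf_add[symmetric] suminf_scaleR_right summable_scaleR_right)
  then have "norm (suminf f) \<le> 2 * norm (ell2_ip a a) + 2 * norm (ell2_ip b b)"
    using norm_triangle_ineq[of "2 *\<^sub>R ell2_ip a a" "2 *\<^sub>R ell2_ip b b"] by simp
  then show "(\<lambda>n. a n + b n) \<in> ell2"
    "(ell2_norm (\<lambda>n. a n + b n))\<^sup>2 \<le> 2 * ((ell2_norm a)\<^sup>2 + (ell2_norm b)\<^sup>2)"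
    using summable_comparison_psd[OF f g fg]
    by (auto simp: ell2_def ell2_norm_square ell2_ip_def g_def)
qed

lemma ell2_scaleC:
  fixes a :: "nat \<Rightarrow> 'a::unital_cstar_algebra"
  assumes "a \<in> ell2"
  shows "(\<lambda>n. c *\<^sub>C a n) \<in> ell2" "ell2_norm (\<lambda>n. c *\<^sub>C a n) = cmod c * ell2_norm a"
proof -
  have "(c *\<^sub>C x) * star (c *\<^sub>C x) = (cmod c)\<^sup>2 *\<^sub>R (x * star x)" for x :: 'a
    unfolding scaleR_scaleC complex_norm_square
    by (simp add: mult_scaleC_left mult_scaleC_right scaleC_scaleC mult.commute)
  moreover have "summable (\<lambda>n. a n * star (a n))"
    using assms by (simp add: ell2_def)
  ultimately show "(\<lambda>n. c *\<^sub>C a n) \<in> ell2" "ell2_norm (\<lambda>n. c *\<^sub>C a n) = cmod c * ell2_norm a"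
    by (simp_all only: ell2_def ell2_norm_def ell2_ip_def mem_Collect_eq summable_scaleR_right
        suminf_scaleR_right[symmetric] norm_scaleR real_sqrt_mult abs_power2 real_sqrt_abs abs_norm_cancel)
qed

lemma ell2_scaleR:
  assumes "a \<in> ell2"
  shows "(\<lambda>n. r *\<^sub>R a n) \<in> ell2" "ell2_norm (\<lambda>n. r *\<^sub>R a n) = \<bar>r\<bar> * ell2_norm a"
  using ell2_scaleC[OF assms, of "complex_of_real r"] by (simp_all add: scaleR_scaleC)

lemma ell2_ip_self_selfadjoint:
  assumes "a \<in> ell2"
  shows "star (ell2_ip a a) = ell2_ip a a"
  using assms unfolding ell2_def ell2_ip_def
  by (intro psd_selfadjoint psd_suminf psd_mult_star_self) simp

text \<open>\<open>f z\<close> is the expansion of the square of x + z y: \<open>p\<close> and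
  \<open>q\<close> are the mixed products, \<open>r\<close> and \<open>s\<close> the squares.
  Without reference to a product, it serves terms of sequences and the module alike.\<close>

lemma polarization_identity:
  fixes p q r s :: "'a::complex_normed_vector"
  defines "f \<equiv> \<lambda>z. r + (z * cnj z) *\<^sub>C s + (cnj z *\<^sub>C p + z *\<^sub>C q)"
  shows "4 *\<^sub>R p = f 1 - f (-1) + \<i> *\<^sub>C f \<i> - \<i> *\<^sub>C f (- \<i>)"
proof -
  have "4 *\<^sub>R p = p + p + (p + p)"
    using scaleR_add_left[of 2 2 p] by (simp add: scaleR_2)
  then show ?thesis
    by (simp add: f_def scaleC_add_right scaleC_diff_right scaleC_scaleC scaleC_minus_left
        scaleC_minus_right)
qed

text \<open>Polarization is applied termwise because convergence of the mixed series is itself at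
  stake; it follows from that of four series of squares.\<close>

lemma ell2_ip_polarization:
  assumes a: "a \<in> ell2" and b: "b \<in> ell2"
  shows "summable (\<lambda>n. a n * star (b n))"
    "norm (ell2_ip a b) \<le> 2 * ((ell2_norm a)\<^sup>2 + (ell2_norm b)\<^sup>2)"
proof -
  define f where "f = (\<lambda>z n. (a n + z *\<^sub>C b n) * star (a n + z *\<^sub>C b n))"
  have sf: "summable (f z)" for z
    using ell2_add(1)[OF a ell2_scaleC(1)[OF b, of z]] by (simp only: ell2_def f_def mem_Collect_eq)
  have nf: "norm (suminf (f z)) \<le> 2 * ((ell2_norm a)\<^sup>2 + (ell2_norm b)\<^sup>2)" if "cmod z = 1" for z
    using ell2_add(2)[OF a ell2_scaleC(1)[OF b, of z]] ell2_scaleC(2)[OF b, of z] that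
    by (simp only: ell2_norm_square f_def ell2_ip_def mult_1_left)
  have eq: "4 *\<^sub>R (a n * star (b n)) = f 1 n - f (-1) n + \<i> *\<^sub>C f \<i> n - \<i> *\<^sub>C f (- \<i>) n" for n
  proof -
    have "f z n = a n * star (a n) + (z * cnj z) *\<^sub>C (b n * star (b n))
      + (cnj z *\<^sub>C (a n * star (b n)) + z *\<^sub>C (b n * star (a n)))" for z
      by (simp add: f_def mult_scaleC_left mult_scaleC_right scaleC_scaleC
          scaleC_add_right algebra_simps mult.commute[of "cnj z"])
    then show ?thesis
      by (simp only:) (rule polarization_identity)
  qed
  have "(\<lambda>n. f 1 n - f (-1) n + \<i> *\<^sub>C f \<i> n - \<i> *\<^sub>C f (- \<i>) n) sums
    (suminf (f 1) - suminf (f (-1)) + \<i> *\<^sub>C suminf (f \<i>) - \<i> *\<^sub>C suminf (f (- \<i>)))"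
    by (intro sums_add sums_diff bounded_linear.sums[OF bounded_linear_scaleC] summable_sums sf)
  then have "(\<lambda>n. (1/4) *\<^sub>R (4 *\<^sub>R (a n * star (b n)))) sums
    ((1/4) *\<^sub>R (suminf (f 1) - suminf (f (-1)) + \<i> *\<^sub>C suminf (f \<i>) - \<i> *\<^sub>C suminf (f (- \<i>))))"
    unfolding eq by (rule sums_scaleR_right)
  then have sums: "(\<lambda>n. a n * star (b n)) sums
    ((1/4) *\<^sub>R (suminf (f 1) - suminf (f (-1)) + \<i> *\<^sub>C suminf (f \<i>) - \<i> *\<^sub>C suminf (f (- \<i>))))"
    by simp
  then show "summable (\<lambda>n. a n * star (b n))"
    by (rule sums_summable)
  have "4 *\<^sub>R ell2_ip a b =
    suminf (f 1) - suminf (f (-1)) + \<i> *\<^sub>C suminf (f \<i>) - \<i> *\<^sub>C suminf (f (- \<i>))"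
    unfolding ell2_ip_def by (simp flip: sums_unique[OF sums])
  then have "4 * norm (ell2_ip a b) =
    norm (suminf (f 1) - suminf (f (-1)) + \<i> *\<^sub>C suminf (f \<i>) - \<i> *\<^sub>C suminf (f (- \<i>)))"
    by (metis abs_numeral norm_scaleR)
  also have "\<dots> \<le> norm (suminf (f 1)) + norm (suminf (f (-1))) + norm (\<i> *\<^sub>C suminf (f \<i>))
    + norm (\<i> *\<^sub>C suminf (f (- \<i>)))"
    by (intro norm_triangle_le_diff norm_triangle_le add_right_mono norm_triangle_ineq4)
  finally show "norm (ell2_ip a b) \<le> 2 * ((ell2_norm a)\<^sup>2 + (ell2_norm b)\<^sup>2)"
    using nf[of 1] nf[of "-1"] nf[of "\<i>"] nf[of "- \<i>"] by (simp add: norm_scaleC)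
qed

lemmas ell2_ip_summable = ell2_ip_polarization(1)

lemma ell2_ip_scaleR_inverse:
  "r > 0 \<Longrightarrow> ell2_ip (\<lambda>n. r *\<^sub>R a n) (\<lambda>n. (1/r) *\<^sub>R b n) = ell2_ip a b"
  by (simp add: ell2_ip_def)

lemma norm_ell2_ip_le:
  assumes "a \<in> ell2" "b \<in> ell2"
  shows "norm (ell2_ip a b) \<le> 4 * ell2_norm a * ell2_norm b"
proof (rule le_four_mult_if_scaled)
  fix r :: real assume r: "r > 0"
  show "norm (ell2_ip a b) \<le> 2 * ((r * ell2_norm a)\<^sup>2 + (ell2_norm b / r)\<^sup>2)"
    using ell2_ip_polarization(2)[OF ell2_scaleR(1)[OF assms(1), of r] ell2_scaleR(1)[OF assms(2), of "1/r"]]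
      ell2_scaleR(2)[OF assms(1), of r] ell2_scaleR(2)[OF assms(2), of "1/r"] r
    by (simp add: ell2_ip_scaleR_inverse)
qed simp_all

lemma ell2_ip_add_left:
  assumes "a \<in> ell2" "b \<in> ell2" "c \<in> ell2"
  shows "ell2_ip (\<lambda>n. a n + b n) c = ell2_ip a c + ell2_ip b c"
  using suminf_add[OF ell2_ip_summable ell2_ip_summable, OF assms(1,3,2,3)]
  by (simp add: ell2_ip_def distrib_right)

lemma ell2_ip_scaleC_left:
  assumes "a \<in> ell2" "c \<in> ell2"
  shows "ell2_ip (\<lambda>n. z *\<^sub>C a n) c = z *\<^sub>C ell2_ip a c"
  using bounded_linear.suminf[OF bounded_linear_scaleC ell2_ip_summable[OF assms], of z]
  by (simp add: ell2_ip_def mult_scaleC_left)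

section \<open>Tails of sequences and the standard basis\<close>

definition tail :: "nat \<Rightarrow> (nat \<Rightarrow> 'a::zero) \<Rightarrow> nat \<Rightarrow> 'a" where
  "tail N a = (\<lambda>n. if n < N then 0 else a n)"

lemma tail_sums:
  fixes f :: "nat \<Rightarrow> 'a::real_normed_vector"
  assumes "summable f"
  shows "(\<lambda>n. if n < N then 0 else f n) sums (suminf f - sum f {..<N})"
proof -
  have "(\<lambda>n. f n - (if n \<in> {..<N} then f n else 0)) sums (suminf f - sum f {..<N})"
    by (intro sums_diff summable_sums assms sums_If_finite_set) simp
  moreover have "(\<lambda>n. f n - (if n \<in> {..<N} then f n else 0)) = (\<lambda>n. if n < N then 0 else f n)"
    by auto
  ultimately show ?thesis
    by simp
qed

lemma tail_mult_star: "tail N a n * star (b n) = (if n < N then 0 else a n * star (b n))"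
  by (simp add: tail_def)

lemma tail_mult_star_tail:
  "tail N a n * star (tail N a n) = (if n < N then 0 else a n * star (a n))"
  by (simp add: tail_def)

lemma tail_ell2: "a \<in> ell2 \<Longrightarrow> tail N a \<in> ell2"
  using tail_sums[THEN sums_summable] by (simp add: ell2_def tail_mult_star_tail)

lemma ell2_ip_tail_left:
  assumes "a \<in> ell2" "b \<in> ell2"
  shows "ell2_ip (tail N a) b = ell2_ip a b - (\<Sum>n<N. a n * star (b n))"
  using tail_sums[OF ell2_ip_summable[OF assms], THEN sums_unique, of N]
  by (simp add: ell2_ip_def tail_mult_star)

lemma ell2_norm_tail:
  assumes "a \<in> ell2"
  shows "(\<lambda>N. ell2_norm (tail N a)) \<longlonglongrightarrow> 0"
proof -
  have s: "summable (\<lambda>n. a n * star (a n))"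
    using assms by (simp add: ell2_def)
  have "(\<lambda>N. ell2_ip a a - (\<Sum>n<N. a n * star (a n))) \<longlonglongrightarrow> ell2_ip a a - ell2_ip a a"
    unfolding ell2_ip_def by (intro tendsto_diff tendsto_const summable_LIMSEQ s)
  moreover have "ell2_ip (tail N a) (tail N a) = ell2_ip a a - (\<Sum>n<N. a n * star (a n))" for N
    using tail_sums[OF s, THEN sums_unique, of N] by (simp add: ell2_ip_def tail_mult_star_tail)
  ultimately have "(\<lambda>N. ell2_ip (tail N a) (tail N a)) \<longlonglongrightarrow> 0"
    by simp
  then have "(\<lambda>N. sqrt (norm (ell2_ip (tail N a) (tail N a)))) \<longlonglongrightarrow> sqrt (norm (0::'a))"
    by (intro tendsto_real_sqrt tendsto_norm)
  then show ?thesis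
    by (simp add: ell2_norm_def)
qed

lemma ell2_basis_ell2: "ell2_basis n \<in> ell2"
proof -
  have "(\<lambda>m. ell2_basis n m * star (ell2_basis n m)) = (\<lambda>m. if m = n then 1 else 0 :: 'a)"
    by (auto simp: ell2_basis_def)
  then show ?thesis
    using sums_single[of n "\<lambda>_. 1 :: 'a"] by (simp add: ell2_def sums_summable)
qed

lemma ell2_ip_basis_left: "ell2_ip (ell2_basis n) a = star (a n)"
proof -
  have "(\<lambda>m. ell2_basis n m * star (a m)) = (\<lambda>m. if m = n then star (a m) else 0)"
    by (auto simp: ell2_basis_def)
  then show ?thesis
    using sums_single[of n "\<lambda>m. star (a m)"] by (simp add: ell2_ip_def sums_iff)
qed

section \<open>Bounded operators on Banach spaces\<close>

lemma uniform_boundedness: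
  fixes T :: "'i \<Rightarrow> 'e::banach \<Rightarrow> 'b::real_normed_vector"
  assumes lin: "\<And>i. i \<in> I \<Longrightarrow> bounded_linear (T i)"
    and ptw: "\<And>x. \<exists>B. \<forall>i\<in>I. norm (T i x) \<le> B"
  obtains C where "C > 0" "\<And>i x. i \<in> I \<Longrightarrow> norm (T i x) \<le> C * norm x"
proof -
  define D where "D n = {x. \<forall>i\<in>I. norm (T i x) \<le> real n}" for n :: nat
  have closed: "closed (D n)" for n
  proof -
    have "closed {x. norm (T i x) \<le> real n}" if "i \<in> I" for i
      by (intro closed_Collect_le continuous_intros linear_continuous_on lin that)
    moreover have "D n = (\<Inter>i\<in>I. {x. norm (T i x) \<le> real n})"
      by (auto simp: D_def)
    ultimately show ?thesis
      by (simp add: closed_INT)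
  qed
  have "\<Union> (range D) = UNIV"
  proof -
    have "\<exists>n. x \<in> D n" for x
    proof -
      obtain B where B: "\<forall>i\<in>I. norm (T i x) \<le> B"
        using ptw by blast
      obtain n :: nat where "B \<le> real n"
        using real_arch_simple by blast
      then have "x \<in> D n"
        unfolding D_def using B by force
      then show ?thesis ..
    qed
    then show ?thesis
      by blast
  qed
  then have "\<exists>S\<in>range D. interior S \<noteq> {}"
    using Met_TC.metric_Baire_category_alt[of "range D"] closed
    by (fastforce simp: complete_UNIV)
  then have "\<exists>n. interior (D n) \<noteq> {}"
    by blast
  then obtain n y r where r: "r > 0" "ball y r \<subseteq> D n"
    by (meson all_not_in_conv mem_interior)
  \<comment> \<open>A step of length \<open>r / 2\<close> from the centre stays in the ball, and the
    difference of two values bounded by \<open>n\<close> yields \<open>4 * n / r\<close>. The added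
    1 keeps \<open>C\<close> positive for \<open>n = 0\<close>.\<close>
  define C where "C = 4 * (real n + 1) / r"
  show thesis
  proof (rule that)
    show "C > 0"
      using r(1) by (simp add: C_def)
    fix i x assume i: "i \<in> I"
    interpret bounded_linear "T i"
      by (rule lin[OF i])
    show "norm (T i x) \<le> C * norm x"
    proof (cases "x = 0")
      case False
      define t where "t = r / (2 * norm x)"
      have t: "t > 0"
        using False r(1) by (simp add: t_def)
      have "y + t *\<^sub>R x \<in> ball y r" "y \<in> ball y r"
        using False r(1) by (simp_all add: t_def dist_norm)
      then have "y + t *\<^sub>R x \<in> D n" "y \<in> D n"
        using r(2) by blast+
      then have "norm (T i (y + t *\<^sub>R x)) \<le> real n" "norm (T i y) \<le> real n"
        using i by (auto simp: D_def)
      moreover have "t *\<^sub>R T i x = T i (y + t *\<^sub>R x) - T i y"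
        by (simp add: add scaleR)
      ultimately have "norm (t *\<^sub>R T i x) \<le> 2 * real n"
        using norm_triangle_ineq4[of "T i (y + t *\<^sub>R x)" "T i y"] by simp
      then have "norm (T i x) \<le> 2 * real n / t"
        using t by (simp add: field_simps)
      also have "\<dots> = 4 * real n / r * norm x"
        using False r(1) by (simp add: t_def field_simps)
      also have "\<dots> \<le> C * norm x"
        unfolding C_def using r(1) by (intro mult_right_mono divide_right_mono) simp_all
      finally show ?thesis .
    qed (simp add: zero)
  qed
qed

text \<open>Solutions of \<open>A y + B y = z\<close> are found as fixed points of
  \<open>y \<mapsto> inv A (z - B y)\<close>, which contracts by \<open>k / c\<close> thanks to the
  lower bound on \<open>A\<close>.\<close>

lemma surj_perturbation:
  fixes A B :: "'e::banach \<Rightarrow> 'e"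
  assumes A: "\<And>x y. A (x - y) = A x - A y" "\<And>x. c * norm x \<le> norm (A x)" "surj A"
    and B: "\<And>x y. B (x - y) = B x - B y" "\<And>x. norm (B x) \<le> k * norm x"
    and k: "0 \<le> k" "k < c"
  shows "surj (\<lambda>x. A x + B x)"
proof -
  have "\<exists>y. A y + B y = z" for z
  proof -
    define f where "f y = inv A (z - B y)" for y
    have Af: "A (f y) = z - B y" for y
      by (simp add: f_def surj_f_inv_f[OF A(3)])
    have "dist (f x) (f y) \<le> (k / c) * dist x y" for x y
    proof -
      have "A (f x - f y) = B (y - x)"
        by (simp add: A(1) B(1) Af)
      then have "c * norm (f x - f y) \<le> k * norm (y - x)"
        using A(2)[of "f x - f y"] B(2)[of "y - x"] by simp
      then show ?thesis
        using k by (simp add: dist_norm norm_minus_commute field_simps)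
    qed
    then have "\<exists>!y. f y = y"
      using k by (intro banach_fix_type[of "k / c"]) simp_all
    then obtain y where "f y = y"
      by blast
    then have "A y + B y = z"
      using Af[of y] by simp
    then show ?thesis ..
  qed
  then show ?thesis
    by (metis surjI)
qed

text \<open>A bound on the inverse becomes a lower bound on \<open>f\<close>, with a positive
  constant so that such bounds can be chained.\<close>

lemma invertible_on_iff:
  assumes "\<And>y. y \<in> T \<Longrightarrow> 0 \<le> normT y"
  shows "invertible_on S normS T normT f \<longleftrightarrow>
    bij_betw f S T \<and> (\<exists>K>0. \<forall>x\<in>S. normS x \<le> K * normT (f x))"
proof (cases "bij_betw f S T")
  case True
  have T: "T = f ` S"
    using True by (simp add: bij_betw_imp_surj_on)
  have inv: "inv_into S f (f x) = x" if "x \<in> S" for x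
    using True that by (simp add: bij_betw_inv_into_left)
  have "(\<exists>K. \<forall>x\<in>S. normS x \<le> K * normT (f x)) \<longleftrightarrow> (\<exists>K>0. \<forall>x\<in>S. normS x \<le> K * normT (f x))"
  proof
    assume "\<exists>K. \<forall>x\<in>S. normS x \<le> K * normT (f x)"
    then obtain K where K: "\<And>x. x \<in> S \<Longrightarrow> normS x \<le> K * normT (f x)"
      by blast
    have "normS x \<le> (\<bar>K\<bar> + 1) * normT (f x)" if "x \<in> S" for x
      using that assms T by (intro order_trans[OF K[OF that] mult_right_mono]) auto
    then show "\<exists>K>0. \<forall>x\<in>S. normS x \<le> K * normT (f x)"
      by (intro exI[of _ "\<bar>K\<bar> + 1"]) simp
  qed blast
  then show ?thesis
    using True inv unfolding invertible_on_def bounded_on_def T by simp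
qed (simp add: invertible_on_def)

lemma invertible_on_compose_iff:
  assumes P: "bij_betw P S' S" "\<And>x. x \<in> S' \<Longrightarrow> normS' x \<le> p * normS (P x)"
      "\<And>x. x \<in> S' \<Longrightarrow> normS (P x) \<le> p' * normS' x" "0 < p" "0 < p'"
    and Q: "bij_betw Q T T'" "\<And>x. x \<in> T \<Longrightarrow> normT x \<le> q * normT' (Q x)"
      "\<And>x. x \<in> T \<Longrightarrow> normT' (Q x) \<le> q' * normT x" "0 < q" "0 < q'"
    and U: "U \<in> S \<rightarrow> T"
    and nonneg: "\<And>x. x \<in> T \<Longrightarrow> 0 \<le> normT x" "\<And>x. x \<in> T' \<Longrightarrow> 0 \<le> normT' x"
  shows "invertible_on S normS T normT U \<longleftrightarrow> invertible_on S' normS' T' normT' (Q \<circ> U \<circ> P)"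
proof -
  have "bij_betw U S T \<longleftrightarrow> bij_betw (Q \<circ> U) S T'"
    using U by (intro bij_betw_comp_iff2 Q(1)) blast
  also have "\<dots> \<longleftrightarrow> bij_betw (Q \<circ> U \<circ> P) S' T'"
    by (rule bij_betw_comp_iff[OF P(1)])
  finally have bij: "bij_betw U S T \<longleftrightarrow> bij_betw (Q \<circ> U \<circ> P) S' T'" .
  have PS: "P x \<in> S" if "x \<in> S'" for x
    using P(1) that by (rule bij_betwE[THEN bspec])
  have "(\<exists>K>0. \<forall>x\<in>S. normS x \<le> K * normT (U x)) \<longleftrightarrow>
    (\<exists>K>0. \<forall>x\<in>S'. normS' x \<le> K * normT' ((Q \<circ> U \<circ> P) x))"
  proof
    assume "\<exists>K>0. \<forall>x\<in>S. normS x \<le> K * normT (U x)"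
    then obtain K where K: "K > 0" "\<And>x. x \<in> S \<Longrightarrow> normS x \<le> K * normT (U x)"
      by blast
    have "normS' x \<le> (p * K * q) * normT' (Q (U (P x)))" if x: "x \<in> S'" for x
    proof -
      have "normS' x \<le> p * normS (P x)"
        by (rule P(2)[OF x])
      also have "\<dots> \<le> p * (K * normT (U (P x)))"
        using P(4) K(2)[OF PS[OF x]] by simp
      also have "\<dots> \<le> p * (K * (q * normT' (Q (U (P x)))))"
        using P(4) K(1) Q(2)[OF Pi_mem[OF U PS[OF x]]] by simp
      finally show ?thesis
        by (simp add: mult_ac)
    qed
    then show "\<exists>K>0. \<forall>x\<in>S'. normS' x \<le> K * normT' ((Q \<circ> U \<circ> P) x)"
      using P(4) Q(4) K(1) by (intro exI[of _ "p * K * q"]) simp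
  next
    assume "\<exists>K>0. \<forall>x\<in>S'. normS' x \<le> K * normT' ((Q \<circ> U \<circ> P) x)"
    then obtain K where K: "K > 0" "\<And>x. x \<in> S' \<Longrightarrow> normS' x \<le> K * normT' (Q (U (P x)))"
      by auto
    have "normS a \<le> (p' * K * q') * normT (U a)" if a: "a \<in> S" for a
    proof -
      obtain x where x: "x \<in> S'" "a = P x"
        using P(1) a by (auto simp: bij_betw_def)
      have "normS a \<le> p' * normS' x"
        unfolding x(2) by (rule P(3)[OF x(1)])
      also have "\<dots> \<le> p' * (K * normT' (Q (U a)))"
        using P(5) K(2)[OF x(1)] x(2) by simp
      also have "\<dots> \<le> p' * (K * (q' * normT (U a)))"
        using P(5) K(1) Q(3)[OF Pi_mem[OF U a]] by simp
      finally show ?thesis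
        by (simp add: mult_ac)
    qed
    then show "\<exists>K>0. \<forall>x\<in>S. normS x \<le> K * normT (U x)"
      using P(5) Q(5) K(1) by (intro exI[of _ "p' * K * q'"]) simp
  qed
  then show ?thesis
    by (simp only: invertible_on_iff nonneg bij)
qed

section \<open>Adjointable bijections onto a Hilbert module\<close>

context hilbert_module
begin

lemma norm_square: "(norm x)\<^sup>2 = norm (ip x x)"
  by (simp add: norm_eq_sqrt_ip)

lemma ip_scaleC_left: "ip (c *\<^sub>C x) y = c *\<^sub>C ip x y"
proof -
  have "c *\<^sub>C x = act (c *\<^sub>C 1) x"
    by (simp add: act_scaleC_left act_one)
  then show ?thesis
    by (simp add: ip_act_left mult_scaleC_left)
qed

lemma ip_add_right: "ip z (x + y) = ip z x + ip z y"
  by (subst (1 2 3) ip_commute) (simp add: ip_add_left)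

lemma ip_scaleC_right: "ip x (c *\<^sub>C y) = cnj c *\<^sub>C ip x y"
  by (subst (1 2) ip_commute) (simp add: ip_scaleC_left)

lemma ip_scaleR_right: "ip x (r *\<^sub>R y) = r *\<^sub>R ip x y"
  by (simp add: scaleR_scaleC ip_scaleC_right)

lemma ip_minus_left: "ip (- x) y = - ip x y"
  using ip_scaleC_left[of "-1" x y] by (simp add: scaleC_minus_left)

lemma ip_diff_left: "ip (x - y) z = ip x z - ip y z"
  using ip_add_left[of x "- y" z] by (simp add: ip_minus_left)

lemma ip_sum_left: "ip (sum f F) y = (\<Sum>x\<in>F. ip (f x) y)"
proof (induction F rule: infinite_finite_induct)
  case empty
  show ?case
    using ip_diff_left[of 0 0 y] by simp
next
  case (infinite F)
  then show ?case
    using ip_diff_left[of 0 0 y] by simp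
qed (simp add: ip_add_left)

lemma eq_if_ip_eq: "(\<And>z. ip x z = ip y z) \<Longrightarrow> x = y"
  using ip_eq_zero_iff[of "x - y"] by (simp add: ip_diff_left)

text \<open>Polarization and rescaling as for \<open>ell2\<close>, with the triangle inequality of
  the module norm in place of domination.\<close>

lemma norm_ip_le: "norm (ip x y) \<le> 4 * norm x * norm y"
proof (rule le_four_mult_if_scaled)
  have polar: "norm (ip x y) \<le> 2 * ((norm x)\<^sup>2 + (norm y)\<^sup>2)" for x y
  proof -
    define f where "f z = ip (x + z *\<^sub>C y) (x + z *\<^sub>C y)" for z
    have nf: "norm (f z) \<le> 2 * ((norm x)\<^sup>2 + (norm y)\<^sup>2)" if "cmod z = 1" for z
    proof -
      have "norm (x + z *\<^sub>C y) \<le> norm x + norm y"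
        using norm_triangle_ineq[of x "z *\<^sub>C y"] that by (simp add: norm_scaleC)
      then have "norm (f z) \<le> (norm x + norm y)\<^sup>2"
        by (simp add: f_def flip: norm_square)
      also have "\<dots> \<le> 2 * ((norm x)\<^sup>2 + (norm y)\<^sup>2)"
        using sum_squares_bound[of "norm x" "norm y"] by (simp add: power2_sum)
      finally show ?thesis .
    qed
    have "f z = ip x x + (z * cnj z) *\<^sub>C ip y y + (cnj z *\<^sub>C ip x y + z *\<^sub>C ip y x)" for z
      by (simp add: f_def ip_add_left ip_add_right ip_scaleC_left ip_scaleC_right
          scaleC_add_right scaleC_scaleC mult.commute)
    then have "4 *\<^sub>R ip x y = f 1 - f (-1) + \<i> *\<^sub>C f \<i> - \<i> *\<^sub>C f (- \<i>)"
      by (simp only:) (rule polarization_identity)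
    then have "4 * norm (ip x y) = norm (f 1 - f (-1) + \<i> *\<^sub>C f \<i> - \<i> *\<^sub>C f (- \<i>))"
      by (metis abs_numeral norm_scaleR)
    also have "\<dots> \<le> norm (f 1) + norm (f (-1)) + norm (\<i> *\<^sub>C f \<i>) + norm (\<i> *\<^sub>C f (- \<i>))"
      by (intro norm_triangle_le_diff norm_triangle_le add_right_mono norm_triangle_ineq4)
    finally show ?thesis
      using nf[of 1] nf[of "-1"] nf[of "\<i>"] nf[of "- \<i>"] by (simp add: norm_scaleC)
  qed
  fix r :: real assume r: "r > 0"
  have "ip (r *\<^sub>R x) ((1/r) *\<^sub>R y) = ip x y"
    using r by (simp add: ip_scaleR_right) (simp add: scaleR_scaleC ip_scaleC_left scaleC_scaleC)
  then show "norm (ip x y) \<le> 2 * ((r * norm x)\<^sup>2 + (norm y / r)\<^sup>2)"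
    using polar[of "r *\<^sub>R x" "(1/r) *\<^sub>R y"] r by simp
qed simp_all

lemma bounded_linear_ip_right: "bounded_linear (ip x)"
  by (rule bounded_linear_intro[where K="4 * norm x"])
    (simp_all add: ip_add_right ip_scaleR_right norm_ip_le mult_ac order_trans[OF norm_ip_le])

end

section \<open>Bounds and bijectivity for \<open>V\<close> and its adjoint\<close>

locale adjointable_bijection = hilbert_module act ip
  for act :: "'a::unital_cstar_algebra \<Rightarrow> 'e::complex_banach \<Rightarrow> 'e" and ip +
  fixes V :: "(nat \<Rightarrow> 'a) \<Rightarrow> 'e" and V' :: "'e \<Rightarrow> nat \<Rightarrow> 'a"
  assumes adjoint_ell2: "V' y \<in> ell2"
    and adjoint: "a \<in> ell2 \<Longrightarrow> ip (V a) y = ell2_ip a (V' y)"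
    and invertible: "invertible_on ell2 ell2_norm UNIV norm V"
begin

text \<open>Pairing with the standard basis identifies \<open>V'\<close> as the analysis operator;
  linearity of \<open>V'\<close> is read off from this formula.\<close>

lemma adjoint_apply: "V' y n = ip y (V (ell2_basis n))"
proof -
  have "ip (V (ell2_basis n)) y = star (V' y n)"
    by (simp add: adjoint ell2_basis_ell2 ell2_ip_basis_left)
  then show ?thesis
    using ip_commute[of y "V (ell2_basis n)"] by simp
qed

lemma V_add: "a \<in> ell2 \<Longrightarrow> b \<in> ell2 \<Longrightarrow> V (\<lambda>n. a n + b n) = V a + V b"
  by (rule eq_if_ip_eq) (simp add: adjoint ell2_add adjoint_ell2 ell2_ip_add_left ip_add_left)

lemma V_scaleC: "a \<in> ell2 \<Longrightarrow> V (\<lambda>n. c *\<^sub>C a n) = c *\<^sub>C V a"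
  by (rule eq_if_ip_eq) (simp add: adjoint ell2_scaleC adjoint_ell2 ell2_ip_scaleC_left ip_scaleC_left)

lemma V_bounded_below: obtains K where "K > 0" "\<And>a. a \<in> ell2 \<Longrightarrow> ell2_norm a \<le> K * norm (V a)"
  using invertible by (auto simp: invertible_on_iff)

lemma V_surj: obtains a where "a \<in> ell2" "y = V a"
  using invertible by (auto simp: invertible_on_def bij_betw_def)

text \<open>Uniform boundedness is applied to the maps \<open>ip (V a)\<close> on the complete space
  \<open>'e\<close>, with \<open>a\<close> in the unit ball of \<open>ell2\<close>. Evaluation at
  \<open>V a\<close> then bounds \<open>norm (V a)\<close>.\<close>

lemma V_bounded: obtains C where "C > 0" "\<And>a. a \<in> ell2 \<Longrightarrow> norm (V a) \<le> C * ell2_norm a"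
proof -
  define B :: "(nat \<Rightarrow> 'a) set" where "B = {a \<in> ell2. ell2_norm a \<le> 1}"
  have ptw: "\<exists>K. \<forall>a\<in>B. norm (ip (V a) y) \<le> K" for y
  proof (intro exI ballI)
    fix a assume a: "a \<in> B"
    then have "norm (ip (V a) y) \<le> 4 * ell2_norm a * ell2_norm (V' y)"
      by (simp add: B_def adjoint norm_ell2_ip_le adjoint_ell2)
    also have "\<dots> \<le> 4 * 1 * ell2_norm (V' y)"
      using a by (intro mult_right_mono) (simp_all add: B_def)
    finally show "norm (ip (V a) y) \<le> 4 * 1 * ell2_norm (V' y)" .
  qed
  obtain C where C: "C > 0" "\<And>a y. a \<in> B \<Longrightarrow> norm (ip (V a) y) \<le> C * norm y"
    using uniform_boundedness[of B "\<lambda>a. ip (V a)", OF bounded_linear_ip_right ptw] by metis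
  have unit: "norm (V a) \<le> C" if "a \<in> B" for a
  proof (cases "V a = 0")
    case False
    have "norm (V a) * norm (V a) \<le> C * norm (V a)"
      using C(2)[OF that, of "V a"] by (simp add: power2_eq_square flip: norm_square)
    then show ?thesis
      using False by simp
  qed (use C(1) in simp)
  show thesis
  proof (rule that[OF C(1)])
    fix a :: "nat \<Rightarrow> 'a" assume a: "a \<in> ell2"
    \<comment> \<open>The shift by \<open>e\<close> avoids dividing by \<open>ell2_norm a\<close>,
      which may vanish.\<close>
    have "norm (V a) \<le> C * (ell2_norm a + e)" if e: "e > 0" for e
    proof -
      define t where "t = ell2_norm a + e"
      have t: "t > 0" "ell2_norm a \<le> t"
        using e by (simp_all add: t_def add_nonneg_pos)
      define b where "b = (\<lambda>n. (1/t) *\<^sub>R a n)"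
      have "b \<in> B"
        using ell2_scaleR[OF a, of "1/t"] t by (simp add: B_def b_def)
      moreover have "V b = (1/t) *\<^sub>R V a"
        using V_scaleC[OF a, of "complex_of_real (1/t)"] by (simp add: b_def scaleR_scaleC)
      ultimately have "norm (V a) / t \<le> C"
        using unit[of b] t by simp
      then show ?thesis
        using t(1) by (simp add: t_def pos_divide_le_eq)
    qed
    then have "\<forall>\<^sub>F e in at_right 0. norm (V a) \<le> C * (ell2_norm a + e)"
      by (simp add: eventually_at_filter)
    moreover have "((\<lambda>e. C * (ell2_norm a + e)) \<longlongrightarrow> C * ell2_norm a) (at_right 0)"
      by (auto intro!: tendsto_eq_intros)
    ultimately show "norm (V a) \<le> C * ell2_norm a"
      by (intro tendsto_lowerbound) auto
  qed
qed

lemma adjoint_bounded: obtains C where "C > 0" "\<And>y. ell2_norm (V' y) \<le> C * norm y"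
proof -
  obtain C where C: "C > 0" "\<And>a. a \<in> ell2 \<Longrightarrow> norm (V a) \<le> C * ell2_norm a"
    using V_bounded by blast
  have "ell2_norm (V' y) \<le> 4 * C * norm y" for y
  proof (cases "ell2_norm (V' y) = 0")
    case False
    have "(ell2_norm (V' y))\<^sup>2 = norm (ip (V (V' y)) y)"
      by (simp add: ell2_norm_square adjoint adjoint_ell2)
    also have "\<dots> \<le> 4 * norm (V (V' y)) * norm y"
      by (rule norm_ip_le)
    also have "\<dots> \<le> 4 * (C * ell2_norm (V' y)) * norm y"
      by (intro mult_right_mono mult_left_mono C adjoint_ell2) simp_all
    finally have "ell2_norm (V' y) * ell2_norm (V' y) \<le> (4 * C * norm y) * ell2_norm (V' y)"
      by (simp add: power2_eq_square mult_ac)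
    then show ?thesis
      using False by (auto dest!: mult_right_le_imp_le simp: less_le)
  qed (use C(1) in simp)
  then show thesis
    using C(1) by (intro that[of "4 * C"]) simp_all
qed

lemma adjoint_bounded_below: obtains K where "K > 0" "\<And>y. norm y \<le> K * ell2_norm (V' y)"
proof -
  obtain K where K: "K > 0" "\<And>a. a \<in> ell2 \<Longrightarrow> ell2_norm a \<le> K * norm (V a)"
    using V_bounded_below by blast
  have "norm y \<le> 4 * K * ell2_norm (V' y)" for y
  proof (cases "y = 0")
    case False
    obtain a where a: "a \<in> ell2" "y = V a"
      using V_surj by blast
    have "(norm y)\<^sup>2 = norm (ell2_ip a (V' y))"
      by (simp add: norm_square adjoint[OF a(1), symmetric] flip: a(2))
    also have "\<dots> \<le> 4 * ell2_norm a * ell2_norm (V' y)"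
      by (rule norm_ell2_ip_le[OF a(1) adjoint_ell2])
    also have "\<dots> \<le> 4 * (K * norm y) * ell2_norm (V' y)"
      using K(2)[OF a(1)] a(2) by (intro mult_right_mono mult_left_mono) simp_all
    finally have "norm y * norm y \<le> (4 * K * ell2_norm (V' y)) * norm y"
      by (simp add: power2_eq_square mult_ac)
    then show ?thesis
      using False by simp
  qed (use K(1) in simp)
  then show thesis
    using K(1) by (intro that[of "4 * K"]) simp_all
qed

lemma adjoint_scaleC: "V' (c *\<^sub>C y) = (\<lambda>n. c *\<^sub>C V' y n)"
  by (simp add: fun_eq_iff adjoint_apply ip_scaleC_left)

lemma adjoint_add: "V' (x + y) = (\<lambda>n. V' x n + V' y n)"
  by (simp add: fun_eq_iff adjoint_apply ip_add_left)

text \<open>\<open>T = V V'\<close> is self-adjoint, hence \<open>T + \<i> t\<close> is bounded below uniformly in the real number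
  \<open>t\<close>. It is surjective for large \<open>t\<close>, and by the continuity method surjectivity persists down
  to \<open>t = 0\<close>.\<close>

lemma V_adjoint_surj: "surj (\<lambda>y. V (V' y))"
proof -
  define T where "T y = V (V' y)" for y
  define S where "S t y = T y + (\<i> * complex_of_real t) *\<^sub>C y" for t y
  have T_scaleC: "T (c *\<^sub>C y) = c *\<^sub>C T y" for c y
    by (simp add: T_def adjoint_scaleC V_scaleC adjoint_ell2)
  have T_diff: "T (x - y) = T x - T y" for x y
  proof -
    have "T (x + y) = T x + T y" for x y
      by (simp add: T_def adjoint_add V_add adjoint_ell2)
    from this[of "x - y" y] show ?thesis
      by (simp add: algebra_simps)
  qed
  obtain C C' where C: "C > 0" "\<And>a. a \<in> ell2 \<Longrightarrow> norm (V a) \<le> C * ell2_norm a"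
    and C': "C' > 0" "\<And>y. ell2_norm (V' y) \<le> C' * norm y"
    using V_bounded adjoint_bounded by metis
  define M where "M = C * C'"
  have M: "0 \<le> M" "norm (T y) \<le> M * norm y" for y
  proof -
    have "norm (T y) \<le> C * ell2_norm (V' y)"
      by (simp add: T_def C adjoint_ell2)
    also have "\<dots> \<le> C * (C' * norm y)"
      using C(1) C'(2) by simp
    finally show "norm (T y) \<le> M * norm y" "0 \<le> M"
      using C(1) C'(1) by (simp_all add: M_def)
  qed
  obtain K where K: "K > 0" "\<And>y. norm y \<le> K * ell2_norm (V' y)"
    using adjoint_bounded_below by blast
  \<comment> \<open>\<open>K\<^sup>2\<close> comes from the lower bound on \<open>V'\<close>, the 4
    from \<open>norm_ip_le\<close>; neither depends on \<open>t\<close>.\<close>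
  define c where "c = 1 / (4 * K\<^sup>2)"
  have c: "c > 0"
    using K(1) by (simp add: c_def)
  have below: "c * norm y \<le> norm (S t y)" for t y
  proof (cases "y = 0")
    case False
    have h: "ip (T y) y = ell2_ip (V' y) (V' y)"
      by (simp add: T_def adjoint adjoint_ell2)
    have "ip (S t y) y = ip (T y) y + \<i> *\<^sub>C (t *\<^sub>R ip y y)"
      by (simp add: S_def ip_add_left ip_scaleC_left scaleR_scaleC scaleC_scaleC)
    moreover have "star (ip (T y) y) = ip (T y) y"
      unfolding h by (rule ell2_ip_self_selfadjoint[OF adjoint_ell2])
    moreover have "star (t *\<^sub>R ip y y) = t *\<^sub>R ip y y"
      using ip_commute[of y y] by simp
    ultimately have "norm (ip (T y) y) \<le> norm (ip (S t y) y)"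
      using norm_le_add_imaginary by metis
    then have "(ell2_norm (V' y))\<^sup>2 \<le> 4 * norm (S t y) * norm y"
      using norm_ip_le[of "S t y" y] by (simp add: h ell2_norm_square)
    moreover have "(norm y)\<^sup>2 \<le> (K * ell2_norm (V' y))\<^sup>2"
      by (intro power_mono K) simp
    ultimately have "(norm y)\<^sup>2 \<le> K\<^sup>2 * (4 * norm (S t y) * norm y)"
      by (smt (verit) mult_left_mono power_mult_distrib zero_le_power2)
    then have "norm y * norm y \<le> (4 * K\<^sup>2 * norm (S t y)) * norm y"
      by (simp add: power2_eq_square mult_ac)
    then have "norm y \<le> 4 * K\<^sup>2 * norm (S t y)"
      using False by simp
    then show ?thesis
      using K(1) by (simp add: c_def pos_divide_le_eq mult.commute)
  qed simp
  have S_diff: "S t (x - y) = S t x - S t y" for t x y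
    by (simp add: S_def T_diff scaleC_diff_right)
  obtain N :: nat where N: "M < real N * (c / 2)"
    using reals_Archimedean3[of "c / 2"] c by auto
  \<comment> \<open>The steps of \<open>c / 2\<close> stay below the common lower bound
    \<open>c\<close>. The descent starts above the bound \<open>M\<close> on \<open>T\<close>, where
    \<open>T\<close> is a small perturbation of the scalar \<i> t, and is at 0 for
    \<open>n = N\<close>.\<close>
  have "surj (S (real N * (c / 2) - real n * (c / 2)))" for n
  proof (induction n)
    case 0
    define t where "t = real N * (c / 2)"
    have t: "M < t" "0 < t"
      using N M(1) by (simp_all add: t_def)
    have "surj (\<lambda>y. (\<i> * complex_of_real t) *\<^sub>C y + T y)"
    proof (rule surj_perturbation)
      show "t * norm x \<le> norm ((\<i> * complex_of_real t) *\<^sub>C x)" for x :: 'e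
        using t by (simp add: norm_scaleC norm_mult)
      show "surj (\<lambda>y::'e. (\<i> * complex_of_real t) *\<^sub>C y)"
        using t by (intro surjI[of _ "\<lambda>y. (1 / (\<i> * complex_of_real t)) *\<^sub>C y"])
          (simp add: scaleC_scaleC)
    qed (use M t in \<open>simp_all add: T_diff scaleC_diff_right\<close>)
    then show ?case
      by (simp add: S_def[abs_def] t_def add.commute)
  next
    case (Suc n)
    define t where "t = real N * (c / 2) - real n * (c / 2)"
    have "surj (\<lambda>y. S t y + (- (\<i> * complex_of_real (c / 2))) *\<^sub>C y)"
    proof (rule surj_perturbation)
      show "c * norm x \<le> norm (S t x)" for x
        by (rule below)
      show "surj (S t)"
        using Suc by (simp add: t_def)
      show "norm ((- (\<i> * complex_of_real (c / 2))) *\<^sub>C x) \<le> c / 2 * norm x" for x :: 'e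
        using c by (simp add: norm_scaleC norm_mult norm_divide)
    qed (use c in \<open>simp_all add: S_diff scaleC_diff_right\<close>)
    moreover have "S t y + (- (\<i> * complex_of_real (c / 2))) *\<^sub>C y = S (t - c / 2) y" for y
      by (simp add: S_def add.assoc algebra_simps flip: scaleC_add_left)
    moreover have "t - c / 2 = real N * (c / 2) - real (Suc n) * (c / 2)"
      by (simp add: t_def algebra_simps)
    ultimately show ?case
      by simp
  qed
  from this[of N] have "surj (S 0)"
    by simp
  moreover have "S 0 = (\<lambda>y. V (V' y))"
    using scaleR_scaleC[of 0, where 'a='e] by (simp add: fun_eq_iff S_def T_def)
  ultimately show ?thesis
    by simp
qed

text \<open>\<open>V'\<close> is injective because \<open>V\<close> is surjective. For surjectivity,
  \<open>V b\<close> equals some \<open>V (V' y)\<close>, and \<open>V\<close> is injective.\<close>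

lemma adjoint_bij: "bij_betw V' UNIV ell2"
proof (rule bij_betwI')
  fix x y
  obtain K where K: "K > 0" "\<And>y. norm y \<le> K * ell2_norm (V' y)"
    using adjoint_bounded_below by blast
  have "x = y" if "V' x = V' y"
  proof (rule eq_if_ip_eq)
    fix z
    obtain a where "a \<in> ell2" "z = V a"
      using V_surj by blast
    then have "ip z x = ip z y"
      by (simp add: adjoint that)
    then show "ip x z = ip y z"
      using ip_commute[of x z] ip_commute[of y z] by simp
  qed
  then show "V' x = V' y \<longleftrightarrow> x = y"
    by blast
next
  fix b :: "nat \<Rightarrow> 'a" assume b: "b \<in> ell2"
  obtain y where "V b = V (V' y)"
    using V_adjoint_surj by (metis surjD)
  then have "b = V' y"
    using invertible b adjoint_ell2 by (auto simp: invertible_on_def bij_betw_def dest: inj_onD)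
  then show "\<exists>y\<in>UNIV. b = V' y"
    by blast
qed (rule adjoint_ell2)

text \<open>The remainder of the series is \<open>V (tail N a)\<close>, which tends to 0 because
  \<open>V\<close> is bounded. Pairing with every \<open>y\<close> identifies it without expanding
  finite sequences in the basis.\<close>

lemma synthesis_sums:
  assumes a: "a \<in> ell2"
  shows "(\<lambda>n. act (a n) (V (ell2_basis n))) sums V a"
proof -
  obtain C where C: "C > 0" "\<And>a. a \<in> ell2 \<Longrightarrow> norm (V a) \<le> C * ell2_norm a"
    using V_bounded by blast
  have rem: "(\<Sum>n<N. act (a n) (V (ell2_basis n))) = V a - V (tail N a)" for N
  proof (rule eq_if_ip_eq)
    fix y
    have "star (V' y n) = ip (V (ell2_basis n)) y" for n
      using ip_commute[of y "V (ell2_basis n)"] by (simp add: adjoint_apply)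
    then show "ip (\<Sum>n<N. act (a n) (V (ell2_basis n))) y = ip (V a - V (tail N a)) y"
      by (simp add: ip_sum_left ip_act_left ip_diff_left adjoint a tail_ell2 ell2_ip_tail_left
          adjoint_ell2)
  qed
  have "(\<lambda>N. V (tail N a)) \<longlonglongrightarrow> 0"
  proof (rule Lim_null_comparison)
    show "\<forall>\<^sub>F N in sequentially. norm (V (tail N a)) \<le> C * ell2_norm (tail N a)"
      by (simp add: C tail_ell2 a)
    show "(\<lambda>N. C * ell2_norm (tail N a)) \<longlonglongrightarrow> 0"
      using tendsto_mult_right_zero[OF ell2_norm_tail[OF a]] by simp
  qed
  from tendsto_diff[OF tendsto_const[of "V a"] this] show ?thesis
    by (simp add: sums_def rem)
qed

end

section \<open>The multiplier as a composition\<close>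

lemma modular_riesz_basisE:
  assumes "hilbert_module act ip" "modular_riesz_basis ip X"
  obtains V V' where "adjointable_bijection act ip V V'" "\<And>n. V (ell2_basis n) = X n"
proof -
  interpret hilbert_module act ip
    by fact
  obtain V V' where "V' \<in> UNIV \<rightarrow> ell2" "\<forall>a\<in>ell2. \<forall>y. ip (V a) y = ell2_ip a (V' y)"
    "invertible_on ell2 ell2_norm UNIV norm V" and X: "\<And>n. V (ell2_basis n) = X n"
    using assms(2) unfolding modular_riesz_basis_def adjointable_on_def by auto
  then have "adjointable_bijection act ip V V'"
    by unfold_locales auto
  then show thesis
    using X by (rule that)
qed

theorem proposition4p4:
  fixes act :: "'a::unital_cstar_algebra \<Rightarrow> 'e::complex_banach \<Rightarrow> 'e"
    and ip :: "'e \<Rightarrow> 'e \<Rightarrow> 'a"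
    and U :: "(nat \<Rightarrow> 'a) \<Rightarrow> (nat \<Rightarrow> 'a)"
    and X Y :: "nat \<Rightarrow> 'e"
  assumes "hilbert_module act ip"
    and "finitely_generated act \<or> countably_generated act"
    and "ell2_bounded_linear U"
    and "modular_riesz_basis ip X"
    and "modular_riesz_basis ip Y"
  shows "invertible_on ell2 ell2_norm ell2 ell2_norm U \<longleftrightarrow>
         invertible_on UNIV norm UNIV norm (riesz_multiplier act ip U Y X)"
proof -
  obtain V V' where "adjointable_bijection act ip V V'" and VX: "\<And>n. V (ell2_basis n) = X n"
    using modular_riesz_basisE[OF assms(1,4)] by metis
  then interpret V: adjointable_bijection act ip V V'
    by simp
  obtain W W' where "adjointable_bijection act ip W W'" and WY: "\<And>n. W (ell2_basis n) = Y n"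
    using modular_riesz_basisE[OF assms(1,5)] by metis
  then interpret W: adjointable_bijection act ip W W'
    by simp
  have U: "U \<in> ell2 \<rightarrow> ell2"
    using assms(3) by (simp add: ell2_bounded_linear_def)
  have analysis: "analysis_op ip X = V'"
    by (simp add: fun_eq_iff analysis_op_def V.adjoint_apply VX)
  have synthesis: "synthesis_op act Y a = W a" if "a \<in> ell2" for a
    using W.synthesis_sums[OF that] by (simp add: synthesis_op_def WY sums_iff)
  \<comment> \<open>Synthesis is identified with \<open>W\<close> on \<open>ell2\<close> only, so it
    matters that \<open>V'\<close> and \<open>U\<close> take their values there.\<close>
  have M: "riesz_multiplier act ip U Y X = W \<circ> U \<circ> V'"
    using U by (simp add: riesz_multiplier_def analysis fun_eq_iff synthesis Pi_mem[OF U] V.adjoint_ell2)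
  obtain p p' q q'
    where "p > 0" "\<And>y. norm y \<le> p * ell2_norm (V' y)" "p' > 0" "\<And>y. ell2_norm (V' y) \<le> p' * norm y"
      and "q > 0" "\<And>a. a \<in> ell2 \<Longrightarrow> ell2_norm a \<le> q * norm (W a)"
      and "q' > 0" "\<And>a. a \<in> ell2 \<Longrightarrow> norm (W a) \<le> q' * ell2_norm a"
    using V.adjoint_bounded_below V.adjoint_bounded W.V_bounded_below W.V_bounded by metis
  moreover have "bij_betw W ell2 UNIV"
    using W.invertible by (simp add: invertible_on_def)
  ultimately show ?thesis
    unfolding M using U V.adjoint_bij 
    by (intro invertible_on_compose_iff[where p = p and p' = p' and q = q and q' = q']) auto
qed

end
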